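(* Let $\mathbf{T}=(T,m,e)$ be a monad and $\mathbf{G}=(G,\delta,\varepsilon)$ a comonad on a category $\mathbb{A}$, and let $\lambda:TG\to GT$ be an entwining from $\mathbf{T}$ to $\mathbf{G}$, with induced comonad $\widehat{\mathbf{G}}$ on $\mathbb{A}_T$ and induced monad $\widehat{\mathbf{T}}$ on $\mathbb{A}^G$. (1) Let $K:\mathbb{A}\to(\mathbb{A}_T)^{\widehat{G}}$ be a functor with $U^{\widehat{G}}K=\phi_T$, and let $\beta_K:\phi_T\to\widehat{G}\phi_T$ be the corresponding $\widehat{\mathbf{G}}$-comodule structure on $\phi_T$. Then $K$ is an equivalence of categories if and only if $(T,U_T(\beta_K))$ is $\mathbf{G}$-Galois and the monad $\mathbf{T}$ is of effective descent type (i.e. the functor $\phi_T:\mathbb{A}\to\mathbb{A}_T$ is comonadic). (2) Dually, let $K:\mathbb{A}\to(\mathbb{A}^G)_{\widehat{T}}$ be a functor with $U_{\widehat{T}}K=\phi^G$, and let $\alpha_K:\widehat{T}\phi^G\to\phi^G$ be the corresponding $\widehat{\mathbf{T}}$-module structure on $\phi^G$. Then $K$ is an equivalence of categories if and only if $(G,U^G(\alpha_K))$ is $\mathbf{T}$-Galois and the comonad $\mathbf{G}$ is of effective codescent type (i.e. the functor $\phi^G:\mathbb{A}\to\mathbb{A}^G$ is monadic).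
   Context: For a monad $\mathbf{T}=(T,m,e)$ on $\mathbb{A}$, $\mathbb{A}_T$ is the Eilenberg–Moore category of $\mathbf{T}$-modules (algebras) and $\phi_T\dashv U_T:\mathbb{A}_T\to\mathbb{A}$ the free-forgetful adjunction. For a comonad $\mathbf{G}=(G,\delta,\varepsilon)$ on $\mathbb{A}$, $\mathbb{A}^G$ is the Eilenberg–Moore category of $\mathbf{G}$-comodules (coalgebras) and $U^G\dashv\phi^G:\mathbb{A}\to\mathbb{A}^G$ the forgetful-cofree adjunction. An entwining (mixed distributive law) from $\mathbf{T}$ to $\mathbf{G}$ is a natural transformation $\lambda:TG\to GT$ with $\lambda\cdot eG=Ge$, $\varepsilon T\cdot\lambda=T\varepsilon$, $\delta T\cdot\lambda=G\lambda\cdot\lambda G\cdot T\delta$, $\lambda\cdot mG=Gm\cdot\lambda T\cdot T\lambda$. It induces a comonad $\widehat{\mathbf{G}}$ on $\mathbb{A}_T$: $\widehat{G}(a,h)=(G(a),G(h)\cdot\lambda_a)$, with comultiplication $\delta_a$ and counit $\varepsilon_a$ at $(a,h)$; and a monad $\widehat{\mathbf{T}}$ on $\mathbb{A}^G$: $\widehat{T}(a,\theta)=(T(a),\lambda_a\cdot T(\theta))$, with multiplication $m_a$ and unit $e_a$ at $(a,\theta)$. Thus $U_T\widehat{G}=GU_T$ and $U^G\widehat{T}=TU^G$. A functor $K:\mathbb{A}\to(\mathbb{A}_T)^{\widehat{G}}$ with $U^{\widehat{G}}K=\phi_T$ has the form $K(a)=(\phi_T(a),(\beta_K)_a)$, where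 $\beta_K:\phi_T\to\widehat{G}\phi_T$ is a natural transformation that is a (coassociative and counital) left $\widehat{\mathbf{G}}$-comodule structure on $\phi_T$; then $U_T(\beta_K):T\to GT$ is a left $\mathbf{G}$-comodule structure on the functor $T$. Similarly, a functor $K:\mathbb{A}\to(\mathbb{A}^G)_{\widehat{T}}$ with $U_{\widehat{T}}K=\phi^G$ corresponds to a left $\widehat{\mathbf{T}}$-module structure $\alpha_K:\widehat{T}\phi^G\to\phi^G$, and $U^G(\alpha_K):TG\to G$ is a left $\mathbf{T}$-module structure on the functor $G$. For a left $\mathbf{G}$-comodule structure $\beta:T\to GT$ on $T$, $(T,\beta)$ is $\mathbf{G}$-Galois if the composite $TT\xrightarrow{\beta T}GTT\xrightarrow{Gm}GT$ is an isomorphism. For a left $\mathbf{T}$-module structure $\alpha:TG\to G$ on $G$, $(G,\alpha)$ is $\mathbf{T}$-Galois if the composite $TG\xrightarrow{T\delta}TGG\xrightarrow{\alpha G}GG$ is an isomorphism. A left adjoint functor is comonadic if its comparison functor to the Eilenberg–Moore category of the comonad generated by the adjunction is an equivalence; dually, monadic for right adjoints. *)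

theory Defs
  imports Main
begin

section \<open>Categories, functors, natural transformations\<close>

text \<open>
  Objects and arrows are the elements of two carrier sets. The operations are total functions
  whose values are only meaningful on the carriers (and, for composition, on composable pairs).
\<close>

record ('o, 'm) category =
  Obj :: "'o set"
  Arr :: "'m set"
  Dom :: "'m \<Rightarrow> 'o"
  Cod :: "'m \<Rightarrow> 'o"
  Ide :: "'o \<Rightarrow> 'm"
  Comp :: "'m \<Rightarrow> 'm \<Rightarrow> 'm"  (infixr "\<cdot>\<index>" 65)

definition hom :: "('o, 'm) category \<Rightarrow> 'o \<Rightarrow> 'o \<Rightarrow> 'm set" where
  "hom A a b = {f \<in> Arr A. Dom A f = a \<and> Cod A f = b}"

locale category =
  fixes A :: "('o, 'm) category" (structure)
  assumes dom_closed: "f \<in> Arr A \<Longrightarrow> Dom A f \<in> Obj A"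
    and cod_closed: "f \<in> Arr A \<Longrightarrow> Cod A f \<in> Obj A"
    and id_in_hom: "a \<in> Obj A \<Longrightarrow> Ide A a \<in> hom A a a"
    and comp_in_hom: "f \<in> hom A a b \<Longrightarrow> g \<in> hom A b c \<Longrightarrow> g \<cdot> f \<in> hom A a c"
    and comp_id_right: "f \<in> hom A a b \<Longrightarrow> f \<cdot> Ide A a = f"
    and comp_id_left: "f \<in> hom A a b \<Longrightarrow> Ide A b \<cdot> f = f"
    and comp_assoc: "f \<in> hom A a b \<Longrightarrow> g \<in> hom A b c \<Longrightarrow> h \<in> hom A c d \<Longrightarrow>
      (h \<cdot> g) \<cdot> f = h \<cdot> (g \<cdot> f)"

definition iso :: "('o, 'm) category \<Rightarrow> 'm \<Rightarrow> bool" where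
  "iso A f \<longleftrightarrow> (\<exists>a b g. f \<in> hom A a b \<and> g \<in> hom A b a \<and>
     g \<cdot>\<^bsub>A\<^esub> f = Ide A a \<and> f \<cdot>\<^bsub>A\<^esub> g = Ide A b)"

record ('o, 'm, 'p, 'n) ftr =
  OMap :: "'o \<Rightarrow> 'p"
  AMap :: "'m \<Rightarrow> 'n"

locale cat_functor = A: category A + B: category B
  for A :: "('o, 'm) category" and B :: "('p, 'n) category" +
  fixes F :: "('o, 'm, 'p, 'n, 'z) ftr_scheme"
  assumes obj_closed: "a \<in> Obj A \<Longrightarrow> OMap F a \<in> Obj B"
    and map_in_hom: "f \<in> hom A a b \<Longrightarrow> AMap F f \<in> hom B (OMap F a) (OMap F b)"
    and map_id: "a \<in> Obj A \<Longrightarrow> AMap F (Ide A a) = Ide B (OMap F a)"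
    and map_comp: "f \<in> hom A a b \<Longrightarrow> g \<in> hom A b c \<Longrightarrow>
      AMap F (g \<cdot>\<^bsub>A\<^esub> f) = AMap F g \<cdot>\<^bsub>B\<^esub> AMap F f"

definition id_ftr :: "('o, 'm, 'o, 'm) ftr" where
  "id_ftr = \<lparr>OMap = (\<lambda>a. a), AMap = (\<lambda>f. f)\<rparr>"

definition comp_ftr :: "('p, 'n, 'q, 'k, 'y) ftr_scheme \<Rightarrow> ('o, 'm, 'p, 'n, 'z) ftr_scheme
    \<Rightarrow> ('o, 'm, 'q, 'k) ftr"  (infixr "\<circ>\<circ>" 60) where
  "F \<circ>\<circ> H = \<lparr>OMap = (\<lambda>a. OMap F (OMap H a)), AMap = (\<lambda>f. AMap F (AMap H f))\<rparr>"

text \<open>Equality of functors, compared on the carriers of the source category only.\<close>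

definition eq_ftr :: "('o, 'm) category \<Rightarrow> ('o, 'm, 'p, 'n, 'y) ftr_scheme
    \<Rightarrow> ('o, 'm, 'p, 'n, 'z) ftr_scheme \<Rightarrow> bool" where
  "eq_ftr A F H \<longleftrightarrow> (\<forall>a\<in>Obj A. OMap F a = OMap H a) \<and> (\<forall>f\<in>Arr A. AMap F f = AMap H f)"

locale nat_trans = F: cat_functor A B F + H: cat_functor A B H
  for A :: "('o, 'm) category" and B :: "('p, 'n) category"
    and F :: "('o, 'm, 'p, 'n, 'y) ftr_scheme" and H :: "('o, 'm, 'p, 'n, 'z) ftr_scheme" +
  fixes \<tau> :: "'o \<Rightarrow> 'n"
  assumes component: "a \<in> Obj A \<Longrightarrow> \<tau> a \<in> hom B (OMap F a) (OMap H a)"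
    and naturality: "f \<in> hom A a b \<Longrightarrow> \<tau> b \<cdot>\<^bsub>B\<^esub> AMap F f = AMap H f \<cdot>\<^bsub>B\<^esub> \<tau> a"

locale nat_iso = nat_trans +
  assumes component_iso: "a \<in> Obj A \<Longrightarrow> iso B (\<tau> a)"

definition equivalence :: "('o, 'm) category \<Rightarrow> ('p, 'n) category
    \<Rightarrow> ('o, 'm, 'p, 'n, 'z) ftr_scheme \<Rightarrow> bool" where
  "equivalence A B F \<longleftrightarrow> cat_functor A B F \<and>
     (\<exists>(H :: ('p, 'n, 'o, 'm) ftr) \<sigma> \<tau>. cat_functor B A H \<and>
        nat_iso A A id_ftr (H \<circ>\<circ> F) \<sigma> \<and> nat_iso B B (F \<circ>\<circ> H) id_ftr \<tau>)"

section \<open>Monads, comonads and their Eilenberg--Moore categories\<close>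

record ('o, 'm) monad = "('o, 'm, 'o, 'm) ftr" +
  Mult :: "'o \<Rightarrow> 'm"
  Unit :: "'o \<Rightarrow> 'm"

record ('o, 'm) comonad = "('o, 'm, 'o, 'm) ftr" +
  Comult :: "'o \<Rightarrow> 'm"
  Counit :: "'o \<Rightarrow> 'm"

locale monad =
  endo: cat_functor A A T +
  mult: nat_trans A A "T \<circ>\<circ> T" T "Mult T" +
  unit: nat_trans A A id_ftr T "Unit T"
  for A :: "('o, 'm) category" (structure) and T :: "('o, 'm) monad" +
  assumes mult_assoc: "a \<in> Obj A \<Longrightarrow>
      Mult T a \<cdot> AMap T (Mult T a) = Mult T a \<cdot> Mult T (OMap T a)"
    and unit_left: "a \<in> Obj A \<Longrightarrow> Mult T a \<cdot> Unit T (OMap T a) = Ide A (OMap T a)"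
    and unit_right: "a \<in> Obj A \<Longrightarrow> Mult T a \<cdot> AMap T (Unit T a) = Ide A (OMap T a)"

locale comonad =
  endo: cat_functor A A G +
  comult: nat_trans A A G "G \<circ>\<circ> G" "Comult G" +
  counit: nat_trans A A G id_ftr "Counit G"
  for A :: "('o, 'm) category" (structure) and G :: "('o, 'm) comonad" +
  assumes comult_coassoc: "a \<in> Obj A \<Longrightarrow>
      AMap G (Comult G a) \<cdot> Comult G a = Comult G (OMap G a) \<cdot> Comult G a"
    and counit_left: "a \<in> Obj A \<Longrightarrow> Counit G (OMap G a) \<cdot> Comult G a = Ide A (OMap G a)"
    and counit_right: "a \<in> Obj A \<Longrightarrow> AMap G (Counit G a) \<cdot> Comult G a = Ide A (OMap G a)"

text \<open>
  An arrow between (co)modules is encoded as a triple \<open>(x, f, y)\<close> of its domain, the underlying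
  arrow and its codomain, because the underlying arrow alone does not determine the (co)module
  structures.
\<close>

type_synonym ('o, 'm) em_obj = "'o \<times> 'm"
type_synonym ('o, 'm) em_arr = "('o \<times> 'm) \<times> 'm \<times> ('o \<times> 'm)"

definition Modules :: "('o, 'm) category \<Rightarrow> ('o, 'm) monad
    \<Rightarrow> (('o, 'm) em_obj, ('o, 'm) em_arr) category" where
  "Modules A T =
     (let Ob = {(a, h). a \<in> Obj A \<and> h \<in> hom A (OMap T a) a \<and>
                 h \<cdot>\<^bsub>A\<^esub> Unit T a = Ide A a \<and> h \<cdot>\<^bsub>A\<^esub> AMap T h = h \<cdot>\<^bsub>A\<^esub> Mult T a}
      in \<lparr>Obj = Ob,
          Arr = {((a, h), f, (b, k)) | a h f b k. (a, h) \<in> Ob \<and> (b, k) \<in> Ob \<and> f \<in> hom A a b \<and>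
                   f \<cdot>\<^bsub>A\<^esub> h = k \<cdot>\<^bsub>A\<^esub> AMap T f},
          Dom = (\<lambda>(x, f, y). x),
          Cod = (\<lambda>(x, f, y). y),
          Ide = (\<lambda>(a, h). ((a, h), Ide A a, (a, h))),
          Comp = (\<lambda>(y, g, z) (x, f, y'). (x, g \<cdot>\<^bsub>A\<^esub> f, z))\<rparr>)"

definition Comodules :: "('o, 'm) category \<Rightarrow> ('o, 'm) comonad
    \<Rightarrow> (('o, 'm) em_obj, ('o, 'm) em_arr) category" where
  "Comodules A G =
     (let Ob = {(a, \<theta>). a \<in> Obj A \<and> \<theta> \<in> hom A a (OMap G a) \<and>
                 Counit G a \<cdot>\<^bsub>A\<^esub> \<theta> = Ide A a \<and> AMap G \<theta> \<cdot>\<^bsub>A\<^esub> \<theta> = Comult G a \<cdot>\<^bsub>A\<^esub> \<theta>}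
      in \<lparr>Obj = Ob,
          Arr = {((a, \<theta>), f, (b, \<kappa>)) | a \<theta> f b \<kappa>. (a, \<theta>) \<in> Ob \<and> (b, \<kappa>) \<in> Ob \<and> f \<in> hom A a b \<and>
                   \<kappa> \<cdot>\<^bsub>A\<^esub> f = AMap G f \<cdot>\<^bsub>A\<^esub> \<theta>},
          Dom = (\<lambda>(x, f, y). x),
          Cod = (\<lambda>(x, f, y). y),
          Ide = (\<lambda>(a, \<theta>). ((a, \<theta>), Ide A a, (a, \<theta>))),
          Comp = (\<lambda>(y, g, z) (x, f, y'). (x, g \<cdot>\<^bsub>A\<^esub> f, z))\<rparr>)"

text \<open>The forgetful functor, both from modules and from comodules: $U_T$ and $U^G$.\<close>

definition forget :: "(('o, 'm) em_obj, ('o, 'm) em_arr, 'o, 'm) ftr" where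
  "forget = \<lparr>OMap = (\<lambda>(a, h). a), AMap = (\<lambda>(x, f, y). f)\<rparr>"

definition free :: "('o, 'm) category \<Rightarrow> ('o, 'm) monad
    \<Rightarrow> ('o, 'm, ('o, 'm) em_obj, ('o, 'm) em_arr) ftr" where
  "free A T =
     (let \<phi> = (\<lambda>a. (OMap T a, Mult T a))
      in \<lparr>OMap = \<phi>, AMap = (\<lambda>f. (\<phi> (Dom A f), AMap T f, \<phi> (Cod A f)))\<rparr>)"

definition cofree :: "('o, 'm) category \<Rightarrow> ('o, 'm) comonad
    \<Rightarrow> ('o, 'm, ('o, 'm) em_obj, ('o, 'm) em_arr) ftr" where
  "cofree A G =
     (let \<phi> = (\<lambda>a. (OMap G a, Comult G a))
      in \<lparr>OMap = \<phi>, AMap = (\<lambda>f. (\<phi> (Dom A f), AMap G f, \<phi> (Cod A f)))\<rparr>)"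

text \<open>
  Unit and counit of the free-forgetful adjunction are \<open>Unit T\<close> and \<open>free_counit A T\<close>;
  those of the forgetful-cofree adjunction are \<open>cofree_unit A G\<close> and \<open>Counit G\<close>.
\<close>

definition free_counit :: "('o, 'm) category \<Rightarrow> ('o, 'm) monad
    \<Rightarrow> ('o, 'm) em_obj \<Rightarrow> ('o, 'm) em_arr" where
  "free_counit A T = (\<lambda>(a, h). (OMap (free A T) a, h, (a, h)))"

definition cofree_unit :: "('o, 'm) category \<Rightarrow> ('o, 'm) comonad
    \<Rightarrow> ('o, 'm) em_obj \<Rightarrow> ('o, 'm) em_arr" where
  "cofree_unit A G = (\<lambda>(a, \<theta>). ((a, \<theta>), \<theta>, OMap (cofree A G) a))"

section \<open>Adjunctions, monadicity and comonadicity\<close>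

locale adjunction =
  left: cat_functor A B L +
  right: cat_functor B A R +
  unit: nat_trans A A id_ftr "R \<circ>\<circ> L" \<eta> +
  counit: nat_trans B B "L \<circ>\<circ> R" id_ftr \<epsilon>
  for A :: "('o, 'm) category" and B :: "('p, 'n) category"
    and L :: "('o, 'm, 'p, 'n) ftr" and R :: "('p, 'n, 'o, 'm) ftr"
    and \<eta> :: "'o \<Rightarrow> 'm" and \<epsilon> :: "'p \<Rightarrow> 'n" +
  assumes triangle_left: "a \<in> Obj A \<Longrightarrow>
      \<epsilon> (OMap L a) \<cdot>\<^bsub>B\<^esub> AMap L (\<eta> a) = Ide B (OMap L a)"
    and triangle_right: "b \<in> Obj B \<Longrightarrow>
      AMap R (\<epsilon> b) \<cdot>\<^bsub>A\<^esub> \<eta> (OMap R b) = Ide A (OMap R b)"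

definition adj_comonad :: "('o, 'm, 'p, 'n) ftr \<Rightarrow> ('p, 'n, 'o, 'm) ftr
    \<Rightarrow> ('o \<Rightarrow> 'm) \<Rightarrow> ('p \<Rightarrow> 'n) \<Rightarrow> ('p, 'n) comonad" where
  "adj_comonad L R \<eta> \<epsilon> =
     \<lparr>OMap = OMap (L \<circ>\<circ> R), AMap = AMap (L \<circ>\<circ> R),
      Comult = (\<lambda>b. AMap L (\<eta> (OMap R b))), Counit = \<epsilon>\<rparr>"

definition adj_monad :: "('o, 'm, 'p, 'n) ftr \<Rightarrow> ('p, 'n, 'o, 'm) ftr
    \<Rightarrow> ('o \<Rightarrow> 'm) \<Rightarrow> ('p \<Rightarrow> 'n) \<Rightarrow> ('o, 'm) monad" where
  "adj_monad L R \<eta> \<epsilon> =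
     \<lparr>OMap = OMap (R \<circ>\<circ> L), AMap = AMap (R \<circ>\<circ> L),
      Mult = (\<lambda>a. AMap R (\<epsilon> (OMap L a))), Unit = \<eta>\<rparr>"

text \<open>
  The comparison functors $a \mapsto (L a, L \eta_a)$ into the comodules of the comonad $LR$ and
  $b \mapsto (R b, R \epsilon_b)$ into the modules of the monad $RL$.
\<close>

definition comonad_comparison :: "('o, 'm) category \<Rightarrow> ('o, 'm, 'p, 'n) ftr \<Rightarrow> ('o \<Rightarrow> 'm)
    \<Rightarrow> ('o, 'm, ('p, 'n) em_obj, ('p, 'n) em_arr) ftr" where
  "comonad_comparison A L \<eta> =
     (let C = (\<lambda>a. (OMap L a, AMap L (\<eta> a)))
      in \<lparr>OMap = C, AMap = (\<lambda>f. (C (Dom A f), AMap L f, C (Cod A f)))\<rparr>)"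

definition monad_comparison :: "('p, 'n) category \<Rightarrow> ('p, 'n, 'o, 'm) ftr \<Rightarrow> ('p \<Rightarrow> 'n)
    \<Rightarrow> ('p, 'n, ('o, 'm) em_obj, ('o, 'm) em_arr) ftr" where
  "monad_comparison B R \<epsilon> =
     (let C = (\<lambda>b. (OMap R b, AMap R (\<epsilon> b)))
      in \<lparr>OMap = C, AMap = (\<lambda>f. (C (Dom B f), AMap R f, C (Cod B f)))\<rparr>)"

text \<open>
  \<open>comonadic\<close> is a property of the left adjoint \<open>L\<close>, \<open>monadic\<close> one of the right adjoint \<open>R\<close>,
  in a given adjunction with \<open>L\<close> going from \<open>A\<close> to \<open>B\<close>.
\<close>

definition comonadic :: "('o, 'm) category \<Rightarrow> ('p, 'n) category \<Rightarrow> ('o, 'm, 'p, 'n) ftr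
    \<Rightarrow> ('p, 'n, 'o, 'm) ftr \<Rightarrow> ('o \<Rightarrow> 'm) \<Rightarrow> ('p \<Rightarrow> 'n) \<Rightarrow> bool" where
  "comonadic A B L R \<eta> \<epsilon> \<longleftrightarrow> adjunction A B L R \<eta> \<epsilon> \<and>
     equivalence A (Comodules B (adj_comonad L R \<eta> \<epsilon>)) (comonad_comparison A L \<eta>)"

definition monadic :: "('o, 'm) category \<Rightarrow> ('p, 'n) category \<Rightarrow> ('o, 'm, 'p, 'n) ftr
    \<Rightarrow> ('p, 'n, 'o, 'm) ftr \<Rightarrow> ('o \<Rightarrow> 'm) \<Rightarrow> ('p \<Rightarrow> 'n) \<Rightarrow> bool" where
  "monadic A B L R \<eta> \<epsilon> \<longleftrightarrow> adjunction A B L R \<eta> \<epsilon> \<and>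
     equivalence B (Modules A (adj_monad L R \<eta> \<epsilon>)) (monad_comparison B R \<epsilon>)"

definition effective_descent_type :: "('o, 'm) category \<Rightarrow> ('o, 'm) monad \<Rightarrow> bool" where
  "effective_descent_type A T \<longleftrightarrow>
     comonadic A (Modules A T) (free A T) forget (Unit T) (free_counit A T)"

definition effective_codescent_type :: "('o, 'm) category \<Rightarrow> ('o, 'm) comonad \<Rightarrow> bool" where
  "effective_codescent_type A G \<longleftrightarrow>
     monadic (Comodules A G) A forget (cofree A G) (cofree_unit A G) (Counit G)"

section \<open>Entwinings and Galois functors\<close>

locale entwining =
  T: monad A T +
  G: comonad A G +
  nat_trans A A "T \<circ>\<circ> G" "G \<circ>\<circ> T" \<Lambda>
  for A :: "('o, 'm) category" (structure)
    and T :: "('o, 'm) monad" and G :: "('o, 'm) comonad" and \<Lambda> :: "'o \<Rightarrow> 'm" +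
  assumes entw_unit: "a \<in> Obj A \<Longrightarrow> \<Lambda> a \<cdot> Unit T (OMap G a) = AMap G (Unit T a)"
    and entw_counit: "a \<in> Obj A \<Longrightarrow> Counit G (OMap T a) \<cdot> \<Lambda> a = AMap T (Counit G a)"
    and entw_comult: "a \<in> Obj A \<Longrightarrow>
      Comult G (OMap T a) \<cdot> \<Lambda> a = AMap G (\<Lambda> a) \<cdot> \<Lambda> (OMap G a) \<cdot> AMap T (Comult G a)"
    and entw_mult: "a \<in> Obj A \<Longrightarrow>
      \<Lambda> a \<cdot> Mult T (OMap G a) = AMap G (Mult T a) \<cdot> \<Lambda> (OMap T a) \<cdot> AMap T (\<Lambda> a)"

text \<open>The comonad $\widehat G$ on $A_T$ and the monad $\widehat T$ on $A^G$.\<close>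

definition lift_comonad :: "('o, 'm) category \<Rightarrow> ('o, 'm) comonad \<Rightarrow> ('o \<Rightarrow> 'm)
    \<Rightarrow> (('o, 'm) em_obj, ('o, 'm) em_arr) comonad" where
  "lift_comonad A G \<Lambda> =
     (let Go = (\<lambda>(a, h). (OMap G a, AMap G h \<cdot>\<^bsub>A\<^esub> \<Lambda> a))
      in \<lparr>OMap = Go, AMap = (\<lambda>(x, f, y). (Go x, AMap G f, Go y)),
          Comult = (\<lambda>(a, h). (Go (a, h), Comult G a, Go (Go (a, h)))),
          Counit = (\<lambda>(a, h). (Go (a, h), Counit G a, (a, h)))\<rparr>)"

definition lift_monad :: "('o, 'm) category \<Rightarrow> ('o, 'm) monad \<Rightarrow> ('o \<Rightarrow> 'm)
    \<Rightarrow> (('o, 'm) em_obj, ('o, 'm) em_arr) monad" where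
  "lift_monad A T \<Lambda> =
     (let To = (\<lambda>(a, \<theta>). (OMap T a, \<Lambda> a \<cdot>\<^bsub>A\<^esub> AMap T \<theta>))
      in \<lparr>OMap = To, AMap = (\<lambda>(x, f, y). (To x, AMap T f, To y)),
          Mult = (\<lambda>(a, \<theta>). (To (To (a, \<theta>)), Mult T a, To (a, \<theta>))),
          Unit = (\<lambda>(a, \<theta>). ((a, \<theta>), Unit T a, To (a, \<theta>)))\<rparr>)"

text \<open>
  A functor \<open>K\<close> into a category of (co)modules whose composite with the forgetful functor is \<open>F\<close>
  is given on objects by $K(a) = (F(a), \sigma_a)$; \<open>structure_of K\<close> is the family $\sigma$,
  i.e. $\beta_K$ for comodules and $\alpha_K$ for modules.
\<close>

definition structure_of :: "('o, 'm, ('p, 'n) em_obj, ('p, 'n) em_arr) ftr \<Rightarrow> 'o \<Rightarrow> 'n" where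
  "structure_of K = (\<lambda>a. snd (OMap K a))"

text \<open>
  \<open>comodule_galois A T G \<beta>\<close> says that \<open>(T, \<beta>)\<close> is \<open>G\<close>-Galois, and \<open>module_galois A T G \<alpha>\<close> that
  \<open>(G, \<alpha>)\<close> is \<open>T\<close>-Galois.
\<close>

definition comodule_galois :: "('o, 'm) category \<Rightarrow> ('o, 'm) monad \<Rightarrow> ('o, 'm) comonad
    \<Rightarrow> ('o \<Rightarrow> 'm) \<Rightarrow> bool" where
  "comodule_galois A T G \<beta> \<longleftrightarrow>
     nat_iso A A (T \<circ>\<circ> T) (G \<circ>\<circ> T) (\<lambda>a. AMap G (Mult T a) \<cdot>\<^bsub>A\<^esub> \<beta> (OMap T a))"

definition module_galois :: "('o, 'm) category \<Rightarrow> ('o, 'm) monad \<Rightarrow> ('o, 'm) comonad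
    \<Rightarrow> ('o \<Rightarrow> 'm) \<Rightarrow> bool" where
  "module_galois A T G \<alpha> \<longleftrightarrow>
     nat_iso A A (T \<circ>\<circ> G) (G \<circ>\<circ> G) (\<lambda>a. \<alpha> (OMap G a) \<cdot>\<^bsub>A\<^esub> AMap T (Comult G a))"

end

theory Submission
  imports Defs
begin

text \<open>The first part is an instance of a fact about an arbitrary adjunction with left adjoint \<open>L\<close> from \<open>A\<close>
to \<open>B\<close> and right adjoint \<open>R\<close>, a comonad \<open>H\<close> on \<open>B\<close> and a functor \<open>K\<close> from \<open>A\<close> to \<open>H\<close>-comodules that lies over \<open>L\<close>. Such a
\<open>K\<close> is a coassociative and counital natural coaction \<open>\<beta> : L \<rightarrow> HL\<close>, and the counit \<open>\<epsilon>\<close> turns it into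
a morphism of comonads \<open>canonical b = H \<epsilon>\<^sub>b \<cdot> \<beta>\<^bsub>Rb\<^esub> : LRb \<rightarrow> Hb\<close>. The fact is that \<open>K\<close> is an equivalence
if and only if \<open>canonical\<close> is invertible and \<open>L\<close> is comonadic (\<open>equivalence_iff_canonical_iso\<close>).

If \<open>canonical\<close> is invertible, it identifies the comodules of the two comonads \<open>LR\<close> and \<open>H\<close> and carries
the comparison functor to \<open>K\<close>, so the two are equivalences together. Conversely, let \<open>K\<close> be an
equivalence. The cofree comodule on \<open>b\<close> is isomorphic to some \<open>K r\<close>. Maps from \<open>K a\<close> into it are maps
\<open>L a \<rightarrow> b\<close>, hence maps \<open>a \<rightarrow> R b\<close>, while maps \<open>K a \<rightarrow> K r\<close> are maps \<open>a \<rightarrow> r\<close>. So \<open>r\<close> is isomorphic to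
\<open>R b\<close>, and under this identification the isomorphism \<open>K r \<rightarrow> H b\<close> is \<open>canonical b\<close>.

For the free-forgetful adjunction of \<open>T\<close> and the comonad induced by \<open>G\<close> on \<open>T\<close>-modules,
\<open>canonical (a, h)\<close> is \<open>G h \<cdot> \<beta>\<^sub>a : T a \<rightarrow> G a\<close>. On free modules this is the map that the Galois condition
asks to be invertible. That is enough: a module \<open>(a, h)\<close> is the coequalizer of
\<open>T T a \<rightrightarrows> T a\<close>, this coequalizer splits in the base category, and split coequalizers are
preserved by all functors, so invertibility spreads from \<open>T a\<close> and \<open>T T a\<close> to \<open>a\<close>
(\<open>iso_on_modules_if_iso_on_free_modules\<close>).

The second part is the first one in the opposite category, where \<open>G\<close> is a monad, \<open>T\<close> a comonad and
the same \<open>\<Lambda>\<close> an entwining. Passing to the opposite category turns comodules into modules and reverses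
their arrows; equivalences can be transported along this contravariant isomorphism of categories
(\<open>equivalence_dual_iff\<close>).\<close>

section \<open>Categories and functors\<close>

lemma hom_iff: "f \<in> hom A a b \<longleftrightarrow> f \<in> Arr A \<and> Dom A f = a \<and> Cod A f = b"
  by (simp add: hom_def)

text \<open>The axioms speak of hom-sets, whose end points the simplifier would have to guess. Restated with
\<open>Dom\<close> and \<open>Cod\<close> of the arrows, they become conditional rewrite rules whose premises the simplifier can discharge, and the
same is done for functors and natural transformations.\<close>

context category
begin

lemma ide_simps [simp]:
  assumes "a \<in> Obj A"
  shows "Ide A a \<in> Arr A" "Dom A (Ide A a) = a" "Cod A (Ide A a) = a"
  using id_in_hom[OF assms] by (auto simp: hom_iff)

lemma comp_simps [simp]:
  assumes "f \<in> Arr A" "g \<in> Arr A" "Cod A f = Dom A g"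
  shows "g \<cdot> f \<in> Arr A" "Dom A (g \<cdot> f) = Dom A f" "Cod A (g \<cdot> f) = Cod A g"
  using comp_in_hom[of f "Dom A f" "Cod A f" g "Cod A g"] assms by (auto simp: hom_iff)

lemma comp_ide_simps [simp]:
  "f \<in> Arr A \<Longrightarrow> Dom A f = a \<Longrightarrow> f \<cdot> Ide A a = f"
  "f \<in> Arr A \<Longrightarrow> Cod A f = b \<Longrightarrow> Ide A b \<cdot> f = f"
  using comp_id_left comp_id_right by (auto simp: hom_iff)

lemma assoc:
  "f \<in> Arr A \<Longrightarrow> g \<in> Arr A \<Longrightarrow> h \<in> Arr A \<Longrightarrow> Cod A f = Dom A g \<Longrightarrow> Cod A g = Dom A h \<Longrightarrow>
    (h \<cdot> g) \<cdot> f = h \<cdot> (g \<cdot> f)"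
  using comp_assoc by (auto simp: hom_iff)

declare dom_closed [simp] cod_closed [simp]

lemma iso_obtain_inverse:
  assumes "iso A f" "f \<in> hom A a b"
  obtains g where "g \<in> hom A b a" "g \<cdot> f = Ide A a" "f \<cdot> g = Ide A b"
  using assms unfolding iso_def hom_iff by auto

lemma isoI:
  "f \<in> hom A a b \<Longrightarrow> g \<in> hom A b a \<Longrightarrow> g \<cdot> f = Ide A a \<Longrightarrow> f \<cdot> g = Ide A b \<Longrightarrow> iso A f"
  unfolding iso_def by blast

lemma iso_arr: "iso A f \<Longrightarrow> f \<in> Arr A"
  unfolding iso_def hom_iff by blast

lemma iso_cancel_left:
  assumes k: "iso A k" and f: "f \<in> Arr A" "Cod A f = Dom A k" and g: "g \<in> Arr A" "Cod A g = Dom A k"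
    and eq: "k \<cdot> f = k \<cdot> g"
  shows "f = g"
proof -
  have [simp]: "k \<in> Arr A" using k by (rule iso_arr)
  obtain l where l: "l \<in> hom A (Cod A k) (Dom A k)" "l \<cdot> k = Ide A (Dom A k)"
    using iso_obtain_inverse[OF k, of "Dom A k" "Cod A k"] by (auto simp: hom_iff)
  have "(l \<cdot> k) \<cdot> f = (l \<cdot> k) \<cdot> g"
    using l(1) f g eq by (simp add: assoc hom_iff)
  then show ?thesis using l(2) f g by simp
qed

lemma iso_cancel_right:
  assumes k: "iso A k" and f: "f \<in> Arr A" "Dom A f = Cod A k" and g: "g \<in> Arr A" "Dom A g = Cod A k"
    and eq: "f \<cdot> k = g \<cdot> k"
  shows "f = g"
proof -
  have [simp]: "k \<in> Arr A" using k by (rule iso_arr)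
  obtain l where l: "l \<in> hom A (Cod A k) (Dom A k)" "k \<cdot> l = Ide A (Cod A k)"
    using iso_obtain_inverse[OF k, of "Dom A k" "Cod A k"] by (auto simp: hom_iff)
  have "f \<cdot> (k \<cdot> l) = g \<cdot> (k \<cdot> l)"
    using l(1) f g eq assoc[of l k f] assoc[of l k g] by (simp add: hom_iff)
  then show ?thesis using l(2) f g by simp
qed

lemma iso_comp:
  assumes "iso A f" "iso A g" "Cod A f = Dom A g"
  shows "iso A (g \<cdot> f)"
proof -
  have [simp]: "f \<in> Arr A" "g \<in> Arr A" using assms by (auto intro: iso_arr)
  obtain f' where f': "f' \<in> hom A (Cod A f) (Dom A f)"
      "f' \<cdot> f = Ide A (Dom A f)" "f \<cdot> f' = Ide A (Cod A f)"
    using iso_obtain_inverse[OF assms(1), of "Dom A f" "Cod A f"] by (auto simp: hom_iff)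
  obtain g' where g': "g' \<in> hom A (Cod A g) (Dom A g)"
      "g' \<cdot> g = Ide A (Dom A g)" "g \<cdot> g' = Ide A (Cod A g)"
    using iso_obtain_inverse[OF assms(2), of "Dom A g" "Cod A g"] by (auto simp: hom_iff)
  note [simp] = f'(1)[unfolded hom_iff] g'(1)[unfolded hom_iff] assms(3)
  have "(f' \<cdot> g') \<cdot> (g \<cdot> f) = f' \<cdot> ((g' \<cdot> g) \<cdot> f)" by (simp add: assoc)
  also have "\<dots> = Ide A (Dom A f)" using f' g' by (simp flip: assms(3))
  finally have 1: "(f' \<cdot> g') \<cdot> (g \<cdot> f) = Ide A (Dom A f)" .
  have "(g \<cdot> f) \<cdot> (f' \<cdot> g') = g \<cdot> ((f \<cdot> f') \<cdot> g')" by (simp add: assoc)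
  also have "\<dots> = Ide A (Cod A g)" using f' g' by simp
  finally have 2: "(g \<cdot> f) \<cdot> (f' \<cdot> g') = Ide A (Cod A g)" .
  show ?thesis
    by (rule isoI[OF _ _ 1 2]) (auto simp: hom_iff)
qed

end

context cat_functor
begin

lemma arr_simps [simp]:
  assumes "f \<in> Arr A"
  shows "AMap F f \<in> Arr B" "Dom B (AMap F f) = OMap F (Dom A f)"
    "Cod B (AMap F f) = OMap F (Cod A f)"
  using map_in_hom[of f "Dom A f" "Cod A f"] assms by (auto simp: hom_iff)

declare obj_closed [simp] map_id [simp]

lemma comp:
  "f \<in> Arr A \<Longrightarrow> g \<in> Arr A \<Longrightarrow> Cod A f = Dom A g \<Longrightarrow>
    AMap F (g \<cdot>\<^bsub>A\<^esub> f) = AMap F g \<cdot>\<^bsub>B\<^esub> AMap F f"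
  using map_comp by (auto simp: hom_iff)

lemma map_iso:
  assumes "iso A f"
  shows "iso B (AMap F f)"
proof -
  obtain a b g where *: "f \<in> hom A a b" "g \<in> hom A b a" "g \<cdot>\<^bsub>A\<^esub> f = Ide A a" "f \<cdot>\<^bsub>A\<^esub> g = Ide A b"
    using assms unfolding iso_def by blast
  then have "a \<in> Obj A" "b \<in> Obj A" by (auto simp: hom_iff)
  with * show ?thesis
    by (intro B.isoI[of _ "OMap F a" "OMap F b" "AMap F g"]) (auto simp: hom_iff simp flip: comp)
qed

end

lemma (in nat_trans) comp_simps [simp]:
  assumes "a \<in> Obj A"
  shows "\<tau> a \<in> Arr B" "Dom B (\<tau> a) = OMap F a" "Cod B (\<tau> a) = OMap H a"
  using component[OF assms] by (auto simp: hom_iff)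

lemma (in nat_trans) natural:
  "f \<in> Arr A \<Longrightarrow> \<tau> (Cod A f) \<cdot>\<^bsub>B\<^esub> AMap F f = AMap H f \<cdot>\<^bsub>B\<^esub> \<tau> (Dom A f)"
  using naturality by (auto simp: hom_iff)

lemma ftr_simps [simp]:
  "OMap (F \<circ>\<circ> H) a = OMap F (OMap H a)" "AMap (F \<circ>\<circ> H) f = AMap F (AMap H f)"
  "OMap id_ftr a = a" "AMap id_ftr f = f"
  by (simp_all add: comp_ftr_def id_ftr_def)

lemma cat_functor_id: "category A \<Longrightarrow> cat_functor A A id_ftr"
  by (auto intro!: cat_functor.intro cat_functor_axioms.intro)

lemma cat_functor_comp:
  assumes "cat_functor A B F" "cat_functor B C H"
  shows "cat_functor A C (H \<circ>\<circ> F)"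
proof -
  interpret F: cat_functor A B F by fact
  interpret H: cat_functor B C H by fact
  show ?thesis
    by unfold_locales (auto simp: F.comp H.comp hom_iff)
qed


section \<open>Equivalences are the fully faithful, essentially surjective functors\<close>

text \<open>This characterization replaces the choice of a quasi-inverse by conditions on hom-sets and objects.
In this form equivalences can be compared when the target category or its direction changes.\<close>

definition fully_faithful :: "('o, 'm) category \<Rightarrow> ('p, 'n) category
    \<Rightarrow> ('o, 'm, 'p, 'n, 'z) ftr_scheme \<Rightarrow> bool" where
  "fully_faithful A B F \<longleftrightarrow> (\<forall>a\<in>Obj A. \<forall>b\<in>Obj A.
     bij_betw (AMap F) (hom A a b) (hom B (OMap F a) (OMap F b)))"

definition essentially_surjective :: "('o, 'm) category \<Rightarrow> ('p, 'n) category
    \<Rightarrow> ('o, 'm, 'p, 'n, 'z) ftr_scheme \<Rightarrow> bool" where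
  "essentially_surjective A B F \<longleftrightarrow>
     (\<forall>b\<in>Obj B. \<exists>a\<in>Obj A. \<exists>k\<in>hom B (OMap F a) b. iso B k)"

lemma equivalence_imp_fully_faithful:
  assumes "equivalence A B F"
  shows "fully_faithful A B F"
proof -
  obtain H :: "('c, 'd, 'a, 'b) ftr" and \<sigma> \<tau> where "cat_functor A B F" "cat_functor B A H"
      "nat_iso A A id_ftr (H \<circ>\<circ> F) \<sigma>" "nat_iso B B (F \<circ>\<circ> H) id_ftr \<tau>"
    using assms unfolding equivalence_def by blast
  then interpret F: cat_functor A B F + H: cat_functor B A H +
    \<sigma>: nat_iso A A id_ftr "H \<circ>\<circ> F" \<sigma> + \<tau>: nat_iso B B "F \<circ>\<circ> H" id_ftr \<tau>
    by simp_all
  have faithful_H: "g = g'"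
    if "g \<in> hom B x y" "g' \<in> hom B x y" "AMap H g = AMap H g'" for g g' x y
  proof -
    have eq: "g \<cdot>\<^bsub>B\<^esub> \<tau> x = g' \<cdot>\<^bsub>B\<^esub> \<tau> x"
      using \<tau>.naturality[of g x y] \<tau>.naturality[of g' x y] that by simp
    show ?thesis
      by (rule F.B.iso_cancel_right[OF _ _ _ _ _ eq]) (use that \<tau>.component_iso[of x] in \<open>auto simp: hom_iff\<close>)
  qed
  show ?thesis
    unfolding fully_faithful_def
  proof (intro ballI bij_betw_imageI inj_onI equalityI subsetI)
    fix a b f f'
    assume *: "a \<in> Obj A" "b \<in> Obj A" "f \<in> hom A a b" "f' \<in> hom A a b" "AMap F f = AMap F f'"
    then have eq: "\<sigma> b \<cdot>\<^bsub>A\<^esub> f = \<sigma> b \<cdot>\<^bsub>A\<^esub> f'"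
      using \<sigma>.naturality[of f a b] \<sigma>.naturality[of f' a b] by simp
    show "f = f'"
      by (rule F.A.iso_cancel_left[OF _ _ _ _ _ eq]) (use * \<sigma>.component_iso[of b] in \<open>auto simp: hom_iff\<close>)
  next
    fix a b g assume "a \<in> Obj A" "b \<in> Obj A" "g \<in> AMap F ` hom A a b"
    then show "g \<in> hom B (OMap F a) (OMap F b)" using F.map_in_hom by blast
  next
    fix a b g assume a [simp]: "a \<in> Obj A" and b [simp]: "b \<in> Obj A" and "g \<in> hom B (OMap F a) (OMap F b)"
    then have [simp]: "g \<in> Arr B" "Dom B g = OMap F a" "Cod B g = OMap F b" by (auto simp: hom_iff)
    \<comment> \<open>Naturality of \<open>\<sigma>\<close> forces the preimage of \<open>g\<close> to be \<open>\<sigma>\<^sub>b\<close> inverse after \<open>H g \<cdot> \<sigma>\<^sub>a\<close>.\<close>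
    obtain s where s: "s \<in> hom A (OMap H (OMap F b)) b"
        "\<sigma> b \<cdot>\<^bsub>A\<^esub> s = Ide A (OMap H (OMap F b))"
      using F.A.iso_obtain_inverse[OF \<sigma>.component_iso[OF b] \<sigma>.component[OF b]] by auto
    note [simp] = s(1)[unfolded hom_iff]
    define f where "f = s \<cdot>\<^bsub>A\<^esub> (AMap H g \<cdot>\<^bsub>A\<^esub> \<sigma> a)"
    have f: "f \<in> hom A a b" by (auto simp: f_def hom_iff)
    have "AMap H (AMap F f) \<cdot>\<^bsub>A\<^esub> \<sigma> a = \<sigma> b \<cdot>\<^bsub>A\<^esub> f"
      using \<sigma>.naturality[OF f] by simp
    also have "\<dots> = (\<sigma> b \<cdot>\<^bsub>A\<^esub> s) \<cdot>\<^bsub>A\<^esub> (AMap H g \<cdot>\<^bsub>A\<^esub> \<sigma> a)"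
      unfolding f_def by (subst F.A.assoc) auto
    also have "\<dots> = AMap H g \<cdot>\<^bsub>A\<^esub> \<sigma> a" by (simp add: s(2))
    finally have eq: "AMap H (AMap F f) \<cdot>\<^bsub>A\<^esub> \<sigma> a = AMap H g \<cdot>\<^bsub>A\<^esub> \<sigma> a" .
    have "AMap H (AMap F f) = AMap H g"
      by (rule F.A.iso_cancel_right[OF _ _ _ _ _ eq]) (use f \<sigma>.component_iso[OF a] in \<open>auto simp: hom_iff\<close>)
    then have "AMap F f = g"
      by (rule faithful_H[rotated 2]) (use f in \<open>auto simp: hom_iff\<close>)
    with f show "g \<in> AMap F ` hom A a b" by blast
  qed
qed

lemma equivalence_imp_essentially_surjective:
  assumes "equivalence A B F"
  shows "essentially_surjective A B F"
proof -
  obtain H :: "('c, 'd, 'a, 'b) ftr" and \<sigma> \<tau> where "cat_functor B A H"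
      "nat_iso B B (F \<circ>\<circ> H) id_ftr \<tau>"
    using assms unfolding equivalence_def by blast
  then interpret H: cat_functor B A H + \<tau>: nat_iso B B "F \<circ>\<circ> H" id_ftr \<tau>
    by simp_all
  show ?thesis
    unfolding essentially_surjective_def
  proof
    fix b assume b: "b \<in> Obj B"
    show "\<exists>a\<in>Obj A. \<exists>k\<in>hom B (OMap F a) b. iso B k"
      using H.obj_closed[OF b] \<tau>.component[OF b] \<tau>.component_iso[OF b] by auto
  qed
qed

text \<open>The quasi-inverse picks for each \<open>b\<close> an object \<open>Q b\<close> with an isomorphism \<open>k b : F (Q b) \<rightarrow> b\<close> and sends
\<open>g\<close> to the unique arrow over its conjugate by these isomorphisms. All required equations hold because
they hold after applying the faithful \<open>F\<close>.\<close>

lemma equivalenceI: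
  fixes A :: "('o, 'm) category" and B :: "('p, 'n) category"
  assumes "cat_functor A B F" and ff: "fully_faithful A B F" and es: "essentially_surjective A B F"
  shows "equivalence A B F"
proof -
  interpret F: cat_functor A B F by fact
  have ex1: "\<exists>!f. f \<in> hom A a b \<and> AMap F f = g"
    if "a \<in> Obj A" "b \<in> Obj A" "g \<in> hom B (OMap F a) (OMap F b)" for a b g
  proof -
    have b: "bij_betw (AMap F) (hom A a b) (hom B (OMap F a) (OMap F b))"
      using ff that(1,2) unfolding fully_faithful_def by blast
    then have "g \<in> AMap F ` hom A a b" using that(3) by (simp add: bij_betw_imp_surj_on)
    then obtain f where "f \<in> hom A a b" "AMap F f = g" by blast
    with b show ?thesis
      by (intro ex1I[of _ f]) (auto dest: bij_betw_imp_inj_on inj_onD)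
  qed
  define lift where "lift a b g = (THE f. f \<in> hom A a b \<and> AMap F f = g)" for a b g
  have lift: "lift a b g \<in> hom A a b" "AMap F (lift a b g) = g"
    if "a \<in> Obj A" "b \<in> Obj A" "g \<in> hom B (OMap F a) (OMap F b)" for a b g
    using theI'[OF ex1[OF that]] unfolding lift_def by blast+
  have faithful: "f = f'"
    if "f \<in> hom A a b" "f' \<in> hom A a b" "AMap F f = AMap F f'" for f f' a b
  proof -
    have "a \<in> Obj A" "b \<in> Obj A" using that by (auto simp: hom_iff)
    then show ?thesis
      using ex1[of a b "AMap F f"] F.map_in_hom[of f a b] that by metis
  qed
  have "\<forall>b\<in>Obj B. \<exists>w. fst w \<in> Obj A \<and> fst (snd w) \<in> hom B (OMap F (fst w)) b \<and>
      snd (snd w) \<in> hom B b (OMap F (fst w)) \<and>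
      snd (snd w) \<cdot>\<^bsub>B\<^esub> fst (snd w) = Ide B (OMap F (fst w)) \<and> fst (snd w) \<cdot>\<^bsub>B\<^esub> snd (snd w) = Ide B b"
  proof
    fix b assume b: "b \<in> Obj B"
    obtain a k where "a \<in> Obj A" "k \<in> hom B (OMap F a) b" "iso B k"
      using es b unfolding essentially_surjective_def by blast
    moreover from this obtain k' where "k' \<in> hom B b (OMap F a)"
        "k' \<cdot>\<^bsub>B\<^esub> k = Ide B (OMap F a)" "k \<cdot>\<^bsub>B\<^esub> k' = Ide B b"
      using F.B.iso_obtain_inverse by blast
    ultimately show "\<exists>w. fst w \<in> Obj A \<and> fst (snd w) \<in> hom B (OMap F (fst w)) b \<and>
      snd (snd w) \<in> hom B b (OMap F (fst w)) \<and>
      snd (snd w) \<cdot>\<^bsub>B\<^esub> fst (snd w) = Ide B (OMap F (fst w)) \<and> fst (snd w) \<cdot>\<^bsub>B\<^esub> snd (snd w) = Ide B b"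
      by (intro exI[of _ "(a, k, k')"]) simp
  qed
  from bchoice[OF this] obtain w
    where w: "\<forall>b\<in>Obj B. fst (w b) \<in> Obj A \<and> fst (snd (w b)) \<in> hom B (OMap F (fst (w b))) b \<and>
      snd (snd (w b)) \<in> hom B b (OMap F (fst (w b))) \<and>
      snd (snd (w b)) \<cdot>\<^bsub>B\<^esub> fst (snd (w b)) = Ide B (OMap F (fst (w b))) \<and>
      fst (snd (w b)) \<cdot>\<^bsub>B\<^esub> snd (snd (w b)) = Ide B b" ..
  define Q k k' where "Q b = fst (w b)" and "k b = fst (snd (w b))" and "k' b = snd (snd (w b))" for b
  note W_defs = this
  from w have Q: "Q b \<in> Obj A" and k: "k b \<in> hom B (OMap F (Q b)) b"
      and k': "k' b \<in> hom B b (OMap F (Q b))"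
      and k'k: "k' b \<cdot>\<^bsub>B\<^esub> k b = Ide B (OMap F (Q b))" and kk': "k b \<cdot>\<^bsub>B\<^esub> k' b = Ide B b"
    if "b \<in> Obj B" for b
    using that unfolding W_defs by simp_all
  note [simp] = Q k[unfolded hom_iff, THEN conjunct1] k[unfolded hom_iff, THEN conjunct2, THEN conjunct1]
    k[unfolded hom_iff, THEN conjunct2, THEN conjunct2]
    k'[unfolded hom_iff, THEN conjunct1] k'[unfolded hom_iff, THEN conjunct2, THEN conjunct1]
    k'[unfolded hom_iff, THEN conjunct2, THEN conjunct2] kk' k'k
  define H :: "('p, 'n, 'o, 'm) ftr" where
    "H = \<lparr>OMap = Q, AMap = (\<lambda>g. lift (Q (Dom B g)) (Q (Cod B g)) (k' (Cod B g) \<cdot>\<^bsub>B\<^esub> (g \<cdot>\<^bsub>B\<^esub> k (Dom B g))))\<rparr>"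
  have H_obj [simp]: "OMap H = Q" by (simp add: H_def)
  have H_arr: "AMap H g \<in> hom A (Q x) (Q y)" "AMap F (AMap H g) = k' y \<cdot>\<^bsub>B\<^esub> (g \<cdot>\<^bsub>B\<^esub> k x)"
    if "g \<in> hom B x y" for g x y
    using lift[of "Q x" "Q y" "k' y \<cdot>\<^bsub>B\<^esub> (g \<cdot>\<^bsub>B\<^esub> k x)"] that by (auto simp: H_def hom_iff)
  have k_cancel [simp]: "k y \<cdot>\<^bsub>B\<^esub> (k' y \<cdot>\<^bsub>B\<^esub> x) = x" if "y \<in> Obj B" "x \<in> Arr B" "Cod B x = y" for x y
    using that by (simp flip: F.B.assoc)
  interpret H: cat_functor B A H
  proof unfold_locales
    fix a assume a [simp]: "a \<in> Obj B"
    show "OMap H a \<in> Obj A" by simp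
    show "AMap H (Ide B a) = Ide A (OMap H a)"
      by (rule faithful[of _ "Q a" "Q a"])
        (use H_arr[OF F.B.id_in_hom[OF a]] in \<open>auto simp: hom_iff\<close>)
  next
    fix f a b assume "f \<in> hom B a b"
    then show "AMap H f \<in> hom A (OMap H a) (OMap H b)" using H_arr by simp
  next
    fix f a b g c assume fg: "f \<in> hom B a b" "g \<in> hom B b c"
    then have [simp]: "f \<in> Arr B" "Dom B f = a" "Cod B f = b" "g \<in> Arr B" "Dom B g = b" "Cod B g = c"
      "a \<in> Obj B" "b \<in> Obj B" "c \<in> Obj B"
      by (auto simp: hom_iff)
    note h = H_arr[OF fg(1)] H_arr[OF fg(2)] H_arr[OF F.B.comp_in_hom[OF fg]]
    show "AMap H (g \<cdot>\<^bsub>B\<^esub> f) = AMap H g \<cdot>\<^bsub>A\<^esub> AMap H f"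
      by (rule faithful[of _ "Q a" "Q c"]) (use h in \<open>auto simp: hom_iff F.B.assoc F.comp\<close>)
  qed
  have s: "lift a (Q (OMap F a)) (k' (OMap F a)) \<in> hom A a (Q (OMap F a))"
    "AMap F (lift a (Q (OMap F a)) (k' (OMap F a))) = k' (OMap F a)" if "a \<in> Obj A" for a
    using lift[of a "Q (OMap F a)" "k' (OMap F a)"] that by (auto simp: hom_iff)
  define \<sigma> where "\<sigma> a = lift a (Q (OMap F a)) (k' (OMap F a))" for a
  note s = s[folded \<sigma>_def]
  have "nat_iso A A id_ftr (H \<circ>\<circ> F) \<sigma>"
  proof (intro nat_iso.intro nat_trans.intro nat_trans_axioms.intro nat_iso_axioms.intro
      cat_functor_id cat_functor_comp[where B = B])
    fix a assume a: "a \<in> Obj A"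
    show "\<sigma> a \<in> hom A (OMap id_ftr a) (OMap (H \<circ>\<circ> F) a)" using s[OF a] by simp
    define r where "r = lift (Q (OMap F a)) a (k (OMap F a))"
    have r: "r \<in> hom A (Q (OMap F a)) a" "AMap F r = k (OMap F a)"
      using lift[of "Q (OMap F a)" a "k (OMap F a)"] a by (auto simp: hom_iff r_def)
    show "iso A (\<sigma> a)"
    proof (rule F.A.isoI[OF s(1)[OF a] r(1)])
      show "r \<cdot>\<^bsub>A\<^esub> \<sigma> a = Ide A a"
        by (rule faithful[of _ a a]) (use s[OF a] r a in \<open>auto simp: hom_iff F.comp\<close>)
      show "\<sigma> a \<cdot>\<^bsub>A\<^esub> r = Ide A (Q (OMap F a))"
        by (rule faithful[of _ "Q (OMap F a)" "Q (OMap F a)"])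
          (use s[OF a] r a in \<open>auto simp: hom_iff F.comp\<close>)
    qed
  next
    fix f a b assume f: "f \<in> hom A a b"
    then have [simp]: "a \<in> Obj A" "b \<in> Obj A" by (auto simp: hom_iff)
    have [simp]: "\<sigma> a \<in> Arr A" "Dom A (\<sigma> a) = a" "Cod A (\<sigma> a) = Q (OMap F a)"
      "\<sigma> b \<in> Arr A" "Dom A (\<sigma> b) = b" "Cod A (\<sigma> b) = Q (OMap F b)"
      using s(1)[of a] s(1)[of b] by (auto simp: hom_iff)
    show "\<sigma> b \<cdot>\<^bsub>A\<^esub> AMap id_ftr f = AMap (H \<circ>\<circ> F) f \<cdot>\<^bsub>A\<^esub> \<sigma> a"
      by (rule faithful[of _ a "Q (OMap F b)"])
        (use f H_arr(2)[OF F.map_in_hom[OF f]] s(2)[of a] s(2)[of b] in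
          \<open>auto simp: hom_iff F.comp F.B.assoc\<close>)
  qed (use F.A.category_axioms F.cat_functor_axioms H.cat_functor_axioms in simp_all)
  moreover have "nat_iso B B (F \<circ>\<circ> H) id_ftr k"
  proof (intro nat_iso.intro nat_trans.intro nat_trans_axioms.intro nat_iso_axioms.intro
      cat_functor_id cat_functor_comp[where B = A])
    fix b assume b: "b \<in> Obj B"
    show "k b \<in> hom B (OMap (F \<circ>\<circ> H) b) (OMap id_ftr b)" using k[OF b] by simp
    show "iso B (k b)"
      by (rule F.B.isoI[OF k[OF b] k'[OF b]]) (use b in simp_all)
  next
    fix g a b assume "g \<in> hom B a b"
    then show "k b \<cdot>\<^bsub>B\<^esub> AMap (F \<circ>\<circ> H) g = AMap id_ftr g \<cdot>\<^bsub>B\<^esub> k a"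
      using H_arr(2)[of g a b] by (auto simp: hom_iff)
  qed (use F.B.category_axioms F.cat_functor_axioms H.cat_functor_axioms in simp_all)
  ultimately show ?thesis
    unfolding equivalence_def using F.cat_functor_axioms H.cat_functor_axioms by blast
qed

theorem equivalence_iff:
  assumes "cat_functor A B F"
  shows "equivalence A B F \<longleftrightarrow> fully_faithful A B F \<and> essentially_surjective A B F"
  using equivalence_imp_fully_faithful equivalence_imp_essentially_surjective equivalenceI[OF assms]
  by blast

section \<open>Categories of modules and comodules\<close>

lemma Comodules_simps [simp]:
  "(a, \<theta>) \<in> Obj (Comodules A G) \<longleftrightarrow> a \<in> Obj A \<and> \<theta> \<in> hom A a (OMap G a) \<and>
     Counit G a \<cdot>\<^bsub>A\<^esub> \<theta> = Ide A a \<and> AMap G \<theta> \<cdot>\<^bsub>A\<^esub> \<theta> = Comult G a \<cdot>\<^bsub>A\<^esub> \<theta>"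
  "(x, f, y) \<in> Arr (Comodules A G) \<longleftrightarrow> x \<in> Obj (Comodules A G) \<and> y \<in> Obj (Comodules A G) \<and>
     f \<in> hom A (fst x) (fst y) \<and> snd y \<cdot>\<^bsub>A\<^esub> f = AMap G f \<cdot>\<^bsub>A\<^esub> snd x"
  "Dom (Comodules A G) (x, f, y) = x"
  "Cod (Comodules A G) (x, f, y) = y"
  "Ide (Comodules A G) x = (x, Ide A (fst x), x)"
  "(y, g, z) \<cdot>\<^bsub>Comodules A G\<^esub> (x, f, y') = (x, g \<cdot>\<^bsub>A\<^esub> f, z)"
  by (cases x; cases y; auto simp: Comodules_def Let_def)+

lemma Modules_simps [simp]:
  "(a, h) \<in> Obj (Modules A T) \<longleftrightarrow> a \<in> Obj A \<and> h \<in> hom A (OMap T a) a \<and>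
     h \<cdot>\<^bsub>A\<^esub> Unit T a = Ide A a \<and> h \<cdot>\<^bsub>A\<^esub> AMap T h = h \<cdot>\<^bsub>A\<^esub> Mult T a"
  "(x, f, y) \<in> Arr (Modules A T) \<longleftrightarrow> x \<in> Obj (Modules A T) \<and> y \<in> Obj (Modules A T) \<and>
     f \<in> hom A (fst x) (fst y) \<and> f \<cdot>\<^bsub>A\<^esub> snd x = snd y \<cdot>\<^bsub>A\<^esub> AMap T f"
  "Dom (Modules A T) (x, f, y) = x"
  "Cod (Modules A T) (x, f, y) = y"
  "Ide (Modules A T) x = (x, Ide A (fst x), x)"
  "(y, g, z) \<cdot>\<^bsub>Modules A T\<^esub> (x, f, y') = (x, g \<cdot>\<^bsub>A\<^esub> f, z)"
  by (cases x; cases y; auto simp: Modules_def Let_def)+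

lemma forget_simps [simp]: "OMap forget x = fst x" "AMap forget f = fst (snd f)"
  by (cases x; simp add: forget_def) (cases f; simp add: forget_def)

lemma hom_Comodules_iff:
  "u \<in> hom (Comodules A G) x y \<longleftrightarrow> (\<exists>f. u = (x, f, y) \<and> (x, f, y) \<in> Arr (Comodules A G))"
  by (cases u) (auto simp: hom_iff simp del: Comodules_simps(2))

lemma hom_Modules_iff:
  "u \<in> hom (Modules A T) x y \<longleftrightarrow> (\<exists>f. u = (x, f, y) \<and> (x, f, y) \<in> Arr (Modules A T))"
  by (cases u) (auto simp: hom_iff simp del: Modules_simps(2))

lemma category_Comodules:
  assumes "cat_functor A A G"
  shows "category (Comodules A (G :: ('o, 'm) comonad))"
proof -
  interpret G: cat_functor A A G by fact
  show ?thesis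
  proof
    fix u assume "u \<in> Arr (Comodules A G)"
    then show "Dom (Comodules A G) u \<in> Obj (Comodules A G)" "Cod (Comodules A G) u \<in> Obj (Comodules A G)"
      by (cases u; simp)+
  next
    fix x assume "x \<in> Obj (Comodules A G)"
    then show "Ide (Comodules A G) x \<in> hom (Comodules A G) x x"
      by (cases x) (simp add: hom_iff)
  next
    fix u v x y z assume "u \<in> hom (Comodules A G) x y" "v \<in> hom (Comodules A G) y z"
    then obtain f g where u: "u = (x, f, y)" "(x, f, y) \<in> Arr (Comodules A G)"
        and v: "v = (y, g, z)" "(y, g, z) \<in> Arr (Comodules A G)"
      unfolding hom_Comodules_iff by blast
    obtain a \<theta> b \<kappa> c \<mu> where [simp]: "x = (a, \<theta>)" "y = (b, \<kappa>)" "z = (c, \<mu>)"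
      by (cases x, cases y, cases z)
    have eq: "\<kappa> \<cdot>\<^bsub>A\<^esub> f = AMap G f \<cdot>\<^bsub>A\<^esub> \<theta>" "\<mu> \<cdot>\<^bsub>A\<^esub> g = AMap G g \<cdot>\<^bsub>A\<^esub> \<kappa>"
      using u(2) v(2) by simp_all
    have "\<mu> \<cdot>\<^bsub>A\<^esub> (g \<cdot>\<^bsub>A\<^esub> f) = (\<mu> \<cdot>\<^bsub>A\<^esub> g) \<cdot>\<^bsub>A\<^esub> f"
      using u(2) v(2) by (subst G.A.assoc) (auto simp: hom_iff)
    also have "\<dots> = AMap G g \<cdot>\<^bsub>A\<^esub> (\<kappa> \<cdot>\<^bsub>A\<^esub> f)"
      using u(2) v(2) unfolding eq(2) by (subst G.A.assoc) (auto simp: hom_iff)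
    also have "\<dots> = AMap G (g \<cdot>\<^bsub>A\<^esub> f) \<cdot>\<^bsub>A\<^esub> \<theta>"
      using u(2) v(2) unfolding eq(1) by (simp add: G.A.assoc hom_iff G.comp)
    finally show "v \<cdot>\<^bsub>Comodules A G\<^esub> u \<in> hom (Comodules A G) x z"
      using u v by (simp add: hom_iff)
  qed (auto simp: hom_Comodules_iff hom_iff G.A.assoc)
qed

lemma category_Modules:
  assumes "cat_functor A A T"
  shows "category (Modules A (T :: ('o, 'm) monad))"
proof -
  interpret T: cat_functor A A T by fact
  show ?thesis
  proof
    fix u assume "u \<in> Arr (Modules A T)"
    then show "Dom (Modules A T) u \<in> Obj (Modules A T)" "Cod (Modules A T) u \<in> Obj (Modules A T)"
      by (cases u; simp)+
  next
    fix x assume "x \<in> Obj (Modules A T)"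
    then show "Ide (Modules A T) x \<in> hom (Modules A T) x x"
      by (cases x) (simp add: hom_iff)
  next
    fix u v x y z assume "u \<in> hom (Modules A T) x y" "v \<in> hom (Modules A T) y z"
    then obtain f g where u: "u = (x, f, y)" "(x, f, y) \<in> Arr (Modules A T)"
        and v: "v = (y, g, z)" "(y, g, z) \<in> Arr (Modules A T)"
      unfolding hom_Modules_iff by blast
    obtain a h b k c l where [simp]: "x = (a, h)" "y = (b, k)" "z = (c, l)"
      by (cases x, cases y, cases z)
    have eq: "f \<cdot>\<^bsub>A\<^esub> h = k \<cdot>\<^bsub>A\<^esub> AMap T f" "g \<cdot>\<^bsub>A\<^esub> k = l \<cdot>\<^bsub>A\<^esub> AMap T g"
      using u(2) v(2) by simp_all
    have "(g \<cdot>\<^bsub>A\<^esub> f) \<cdot>\<^bsub>A\<^esub> h = g \<cdot>\<^bsub>A\<^esub> (f \<cdot>\<^bsub>A\<^esub> h)"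
      using u(2) v(2) by (subst T.A.assoc) (auto simp: hom_iff)
    also have "\<dots> = (g \<cdot>\<^bsub>A\<^esub> k) \<cdot>\<^bsub>A\<^esub> AMap T f"
      using u(2) v(2) unfolding eq(1) by (subst T.A.assoc) (auto simp: hom_iff)
    also have "\<dots> = l \<cdot>\<^bsub>A\<^esub> AMap T (g \<cdot>\<^bsub>A\<^esub> f)"
      using u(2) v(2) unfolding eq(2) by (simp add: T.A.assoc hom_iff T.comp)
    finally show "v \<cdot>\<^bsub>Modules A T\<^esub> u \<in> hom (Modules A T) x z"
      using u v by (simp add: hom_iff)
  qed (auto simp: hom_Modules_iff hom_iff T.A.assoc)
qed

text \<open>Being compatible with the structures is inherited by the inverse of an arrow.\<close>

lemma iso_Comodules_iff:
  assumes "cat_functor A A (G :: ('o, 'm) comonad)" and arr: "(x, f, y) \<in> Arr (Comodules A G)"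
  shows "iso (Comodules A G) (x, f, y) \<longleftrightarrow> iso A f"
proof
  assume "iso (Comodules A G) (x, f, y)"
  then obtain g where "(y, g, x) \<in> Arr (Comodules A G)" "g \<cdot>\<^bsub>A\<^esub> f = Ide A (fst x)" "f \<cdot>\<^bsub>A\<^esub> g = Ide A (fst y)"
    unfolding iso_def by (auto simp: hom_Comodules_iff hom_iff)
  with arr show "iso A f" unfolding iso_def by auto
next
  interpret G: cat_functor A A G by fact
  obtain a \<theta> b \<kappa> where [simp]: "x = (a, \<theta>)" "y = (b, \<kappa>)" by (cases x, cases y)
  from arr have f: "f \<in> hom A a b" and eq: "\<kappa> \<cdot>\<^bsub>A\<^esub> f = AMap G f \<cdot>\<^bsub>A\<^esub> \<theta>" by simp_all
  note [simp] = f[unfolded hom_iff]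
  have [simp]: "a \<in> Obj A" "b \<in> Obj A" "\<theta> \<in> Arr A" "Dom A \<theta> = a" "Cod A \<theta> = OMap G a"
    "\<kappa> \<in> Arr A" "Dom A \<kappa> = b" "Cod A \<kappa> = OMap G b"
    using arr by (simp_all add: hom_iff)
  assume "iso A f"
  then obtain g where g: "g \<in> hom A b a" "g \<cdot>\<^bsub>A\<^esub> f = Ide A a" "f \<cdot>\<^bsub>A\<^esub> g = Ide A b"
    using G.A.iso_obtain_inverse f by blast
  note [simp] = g(1)[unfolded hom_iff]
  have "\<theta> \<cdot>\<^bsub>A\<^esub> g = (AMap G (g \<cdot>\<^bsub>A\<^esub> f) \<cdot>\<^bsub>A\<^esub> \<theta>) \<cdot>\<^bsub>A\<^esub> g" unfolding g(2) by simp
  also have "\<dots> = (AMap G g \<cdot>\<^bsub>A\<^esub> (AMap G f \<cdot>\<^bsub>A\<^esub> \<theta>)) \<cdot>\<^bsub>A\<^esub> g" by (simp add: G.comp G.A.assoc)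
  also have "\<dots> = AMap G g \<cdot>\<^bsub>A\<^esub> (\<kappa> \<cdot>\<^bsub>A\<^esub> (f \<cdot>\<^bsub>A\<^esub> g))"
    unfolding eq[symmetric] by (simp add: G.A.assoc)
  also have "\<dots> = AMap G g \<cdot>\<^bsub>A\<^esub> \<kappa>" unfolding g(3) by simp
  finally have "(y, g, x) \<in> Arr (Comodules A G)" using arr g(1) by simp
  then show "iso (Comodules A G) (x, f, y)"
    unfolding iso_def using arr g by (intro exI[of _ x] exI[of _ y] exI[of _ "(y, g, x)"]) (simp add: hom_iff)
qed

lemma iso_Modules_iff:
  assumes "cat_functor A A (T :: ('o, 'm) monad)" and arr: "(x, f, y) \<in> Arr (Modules A T)"
  shows "iso (Modules A T) (x, f, y) \<longleftrightarrow> iso A f"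
proof
  assume "iso (Modules A T) (x, f, y)"
  then obtain g where "(y, g, x) \<in> Arr (Modules A T)" "g \<cdot>\<^bsub>A\<^esub> f = Ide A (fst x)" "f \<cdot>\<^bsub>A\<^esub> g = Ide A (fst y)"
    unfolding iso_def by (auto simp: hom_Modules_iff hom_iff)
  with arr show "iso A f" unfolding iso_def by auto
next
  interpret T: cat_functor A A T by fact
  obtain a h b k where [simp]: "x = (a, h)" "y = (b, k)" by (cases x, cases y)
  from arr have f: "f \<in> hom A a b" and eq: "f \<cdot>\<^bsub>A\<^esub> h = k \<cdot>\<^bsub>A\<^esub> AMap T f" by simp_all
  note [simp] = f[unfolded hom_iff]
  have [simp]: "a \<in> Obj A" "b \<in> Obj A" "h \<in> Arr A" "Dom A h = OMap T a" "Cod A h = a"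
    "k \<in> Arr A" "Dom A k = OMap T b" "Cod A k = b"
    using arr by (simp_all add: hom_iff)
  assume "iso A f"
  then obtain g where g: "g \<in> hom A b a" "g \<cdot>\<^bsub>A\<^esub> f = Ide A a" "f \<cdot>\<^bsub>A\<^esub> g = Ide A b"
    using T.A.iso_obtain_inverse f by blast
  note [simp] = g(1)[unfolded hom_iff]
  have "g \<cdot>\<^bsub>A\<^esub> k = g \<cdot>\<^bsub>A\<^esub> (k \<cdot>\<^bsub>A\<^esub> AMap T (f \<cdot>\<^bsub>A\<^esub> g))" unfolding g(3) by simp
  also have "\<dots> = g \<cdot>\<^bsub>A\<^esub> ((k \<cdot>\<^bsub>A\<^esub> AMap T f) \<cdot>\<^bsub>A\<^esub> AMap T g)" by (simp add: T.comp T.A.assoc)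
  also have "\<dots> = (g \<cdot>\<^bsub>A\<^esub> f) \<cdot>\<^bsub>A\<^esub> (h \<cdot>\<^bsub>A\<^esub> AMap T g)"
    unfolding eq[symmetric] by (simp add: T.A.assoc)
  also have "\<dots> = h \<cdot>\<^bsub>A\<^esub> AMap T g" unfolding g(2) by simp
  finally have "(y, g, x) \<in> Arr (Modules A T)" using arr g(1) by simp
  then show "iso (Modules A T) (x, f, y)"
    unfolding iso_def using arr g by (intro exI[of _ x] exI[of _ y] exI[of _ "(y, g, x)"]) (simp add: hom_iff)
qed


section \<open>Functors into a category of comodules\<close>

text \<open>A functor over \<open>L\<close> into comodules amounts to a coaction on \<open>L\<close>, so being fully faithful or essentially
surjective can be expressed in \<open>A\<close> and \<open>B\<close> alone.\<close>

locale comodule_functor =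
  L: cat_functor A B L + H: comonad B H + K: cat_functor A "Comodules B H" K
  for A :: "('o, 'm) category" and B :: "('p, 'n) category" and L :: "('o, 'm, 'p, 'n) ftr"
    and H :: "('p, 'n) comonad" and K :: "('o, 'm, ('p, 'n) em_obj, ('p, 'n) em_arr) ftr" +
  assumes over: "eq_ftr A (forget \<circ>\<circ> K) L"
begin

abbreviation \<beta> :: "'o \<Rightarrow> 'n" where "\<beta> \<equiv> structure_of K"

lemma K_obj: "a \<in> Obj A \<Longrightarrow> OMap K a = (OMap L a, \<beta> a)"
  using over by (auto simp: eq_ftr_def structure_of_def prod_eq_iff)

lemma K_arr: "f \<in> hom A a b \<Longrightarrow> AMap K f = (OMap K a, AMap L f, OMap K b)"
  using K.map_in_hom[of f a b] over by (auto simp: hom_Comodules_iff eq_ftr_def hom_iff[of f])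

lemma coaction [simp]:
  assumes "a \<in> Obj A"
  shows "\<beta> a \<in> Arr B" "Dom B (\<beta> a) = OMap L a" "Cod B (\<beta> a) = OMap H (OMap L a)"
  using K.obj_closed[OF assms] assms by (auto simp: K_obj hom_iff)

lemma coaction_counit: "a \<in> Obj A \<Longrightarrow> Counit H (OMap L a) \<cdot>\<^bsub>B\<^esub> \<beta> a = Ide B (OMap L a)"
  and coaction_coassoc: "a \<in> Obj A \<Longrightarrow>
    AMap H (\<beta> a) \<cdot>\<^bsub>B\<^esub> \<beta> a = Comult H (OMap L a) \<cdot>\<^bsub>B\<^esub> \<beta> a"
  using K.obj_closed[of a] by (auto simp: K_obj)

lemma coaction_natural:
  "f \<in> hom A a b \<Longrightarrow> \<beta> b \<cdot>\<^bsub>B\<^esub> AMap L f = AMap H (AMap L f) \<cdot>\<^bsub>B\<^esub> \<beta> a"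
  using K.map_in_hom[of f a b] by (auto simp: K_arr hom_Comodules_iff K_obj hom_iff[of f])

lemma hom_K_iff:
  "a \<in> Obj A \<Longrightarrow> x \<in> Obj (Comodules B H) \<Longrightarrow> u \<in> hom (Comodules B H) (OMap K a) x \<longleftrightarrow>
    (\<exists>g\<in>hom B (OMap L a) (fst x). snd x \<cdot>\<^bsub>B\<^esub> g = AMap H g \<cdot>\<^bsub>B\<^esub> \<beta> a \<and> u = (OMap K a, g, x))"
  using K.obj_closed[of a] by (auto simp: hom_Comodules_iff K_obj)

lemma fully_faithful_iff:
  "fully_faithful A (Comodules B H) K \<longleftrightarrow> (\<forall>a\<in>Obj A. \<forall>b\<in>Obj A. bij_betw (AMap L) (hom A a b)
     {g \<in> hom B (OMap L a) (OMap L b). \<beta> b \<cdot>\<^bsub>B\<^esub> g = AMap H g \<cdot>\<^bsub>B\<^esub> \<beta> a})"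
proof -
  have "bij_betw (AMap K) (hom A a b) (hom (Comodules B H) (OMap K a) (OMap K b)) \<longleftrightarrow>
      bij_betw (AMap L) (hom A a b)
        {g \<in> hom B (OMap L a) (OMap L b). \<beta> b \<cdot>\<^bsub>B\<^esub> g = AMap H g \<cdot>\<^bsub>B\<^esub> \<beta> a}"
    (is "bij_betw _ _ ?homs \<longleftrightarrow> bij_betw _ _ ?S") if ab: "a \<in> Obj A" "b \<in> Obj A" for a b
  proof -
    define c where "c g = (OMap K a, g, OMap K b)" for g :: 'n
    have "bij_betw (AMap L) (hom A a b) ?S \<longleftrightarrow> bij_betw (c \<circ> AMap L) (hom A a b) ?homs"
    proof (rule bij_betw_comp_iff2)
      have "?homs = c ` ?S"
        unfolding set_eq_iff hom_K_iff[OF ab(1) K.obj_closed[OF ab(2)]] c_def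
        by (auto simp: K_obj[OF ab(2)])
      then show "bij_betw c ?S ?homs"
        by (simp add: bij_betw_def inj_on_def c_def)
      show "AMap L ` hom A a b \<subseteq> ?S"
        using L.map_in_hom coaction_natural by auto
    qed
    also have "\<dots> \<longleftrightarrow> bij_betw (AMap K) (hom A a b) ?homs"
      by (rule bij_betw_cong) (simp add: K_arr c_def)
    finally show ?thesis by simp
  qed
  then show ?thesis unfolding fully_faithful_def by simp
qed

lemma essentially_surjective_iff:
  "essentially_surjective A (Comodules B H) K \<longleftrightarrow> (\<forall>b \<theta>. (b, \<theta>) \<in> Obj (Comodules B H) \<longrightarrow>
     (\<exists>a\<in>Obj A. \<exists>k\<in>hom B (OMap L a) b. iso B k \<and> \<theta> \<cdot>\<^bsub>B\<^esub> k = AMap H k \<cdot>\<^bsub>B\<^esub> \<beta> a))"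
proof -
  have *: "(\<exists>u\<in>hom (Comodules B H) (OMap K a) (b, \<theta>). iso (Comodules B H) u) \<longleftrightarrow>
      (\<exists>k\<in>hom B (OMap L a) b. iso B k \<and> \<theta> \<cdot>\<^bsub>B\<^esub> k = AMap H k \<cdot>\<^bsub>B\<^esub> \<beta> a)" (is "?l \<longleftrightarrow> ?r")
    if a: "a \<in> Obj A" and b: "(b, \<theta>) \<in> Obj (Comodules B H)" for a b \<theta>
  proof -
    have *: "iso (Comodules B H) (OMap K a, k, (b, \<theta>)) \<longleftrightarrow> iso B k"
      if "k \<in> hom B (OMap L a) b" "\<theta> \<cdot>\<^bsub>B\<^esub> k = AMap H k \<cdot>\<^bsub>B\<^esub> \<beta> a" for k
      using iso_Comodules_iff[OF H.endo.cat_functor_axioms, of "OMap K a" k "(b, \<theta>)"]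
        K.obj_closed[OF a] a b that by (simp add: K_obj)
    show ?thesis
    proof
      assume ?l
      then obtain k where k: "k \<in> hom B (OMap L a) b" "\<theta> \<cdot>\<^bsub>B\<^esub> k = AMap H k \<cdot>\<^bsub>B\<^esub> \<beta> a"
          and iso: "iso (Comodules B H) (OMap K a, k, (b, \<theta>))"
        unfolding Bex_def hom_K_iff[OF a b] by auto
      show ?r using k iso[unfolded *[OF k]] by blast
    next
      assume ?r
      then obtain k where k: "k \<in> hom B (OMap L a) b" "\<theta> \<cdot>\<^bsub>B\<^esub> k = AMap H k \<cdot>\<^bsub>B\<^esub> \<beta> a"
          and "iso B k" by blast
      then have "iso (Comodules B H) (OMap K a, k, (b, \<theta>))" using *[OF k] by blast
      moreover have "(OMap K a, k, (b, \<theta>)) \<in> hom (Comodules B H) (OMap K a) (b, \<theta>)"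
        using k unfolding hom_K_iff[OF a b] by simp
      ultimately show ?l by blast
    qed
  qed
  have "essentially_surjective A (Comodules B H) K \<longleftrightarrow> (\<forall>b \<theta>. (b, \<theta>) \<in> Obj (Comodules B H) \<longrightarrow>
      (\<exists>a\<in>Obj A. \<exists>u\<in>hom (Comodules B H) (OMap K a) (b, \<theta>). iso (Comodules B H) u))"
    unfolding essentially_surjective_def Ball_def split_paired_All by (rule refl)
  also have "\<dots> \<longleftrightarrow> (\<forall>b \<theta>. (b, \<theta>) \<in> Obj (Comodules B H) \<longrightarrow>
      (\<exists>a\<in>Obj A. \<exists>k\<in>hom B (OMap L a) b. iso B k \<and> \<theta> \<cdot>\<^bsub>B\<^esub> k = AMap H k \<cdot>\<^bsub>B\<^esub> \<beta> a))"
    by (intro iff_allI imp_cong bex_cong refl *)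
  finally show ?thesis .
qed

end

locale comonad_iso =
  H1: comonad B H1 + H2: comonad B H2 + nat_iso B B H1 H2 t
  for B :: "('p, 'n) category" (structure) and H1 H2 :: "('p, 'n) comonad" and t :: "'p \<Rightarrow> 'n" +
  assumes counit: "b \<in> Obj B \<Longrightarrow> Counit H2 b \<cdot> t b = Counit H1 b"
    and comult: "b \<in> Obj B \<Longrightarrow> Comult H2 b \<cdot> t b = AMap H2 (t b) \<cdot> t (OMap H1 b) \<cdot> Comult H1 b"
begin

text \<open>Coassociativity for \<open>H2\<close> is coassociativity for \<open>H1\<close> followed by the isomorphism from \<open>H1 H1\<close> to
\<open>H2 H2\<close>, which can be cancelled; this is what makes the converse direction hold.\<close>

lemma comodule_iff:
  assumes \<theta>: "\<theta> \<in> hom B b (OMap H1 b)"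
  shows "(b, t b \<cdot> \<theta>) \<in> Obj (Comodules B H2) \<longleftrightarrow> (b, \<theta>) \<in> Obj (Comodules B H1)"
proof (cases "b \<in> Obj B")
  case [simp]: True
  note [simp] = \<theta>[unfolded hom_iff]
  have counit': "Counit H2 b \<cdot> (t b \<cdot> \<theta>) = Counit H1 b \<cdot> \<theta>"
    by (simp add: counit flip: H1.endo.A.assoc)
  have l: "AMap H2 (t b \<cdot> \<theta>) \<cdot> (t b \<cdot> \<theta>) = (AMap H2 (t b) \<cdot> t (OMap H1 b)) \<cdot> (AMap H1 \<theta> \<cdot> \<theta>)"
  proof -
    have "AMap H2 (t b \<cdot> \<theta>) \<cdot> (t b \<cdot> \<theta>) = AMap H2 (t b) \<cdot> ((AMap H2 \<theta> \<cdot> t b) \<cdot> \<theta>)"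
      by (simp add: H2.endo.comp H1.endo.A.assoc)
    also have "AMap H2 \<theta> \<cdot> t b = t (OMap H1 b) \<cdot> AMap H1 \<theta>"
      using naturality[OF \<theta>] by simp
    finally show ?thesis by (simp add: H1.endo.A.assoc)
  qed
  have r: "Comult H2 b \<cdot> (t b \<cdot> \<theta>) = (AMap H2 (t b) \<cdot> t (OMap H1 b)) \<cdot> (Comult H1 b \<cdot> \<theta>)"
    by (simp add: comult H1.endo.A.assoc flip: H1.endo.A.assoc[of \<theta> "t b"])
  have "iso B (AMap H2 (t b) \<cdot> t (OMap H1 b))"
    by (rule H1.endo.A.iso_comp) (simp_all add: component_iso H2.endo.map_iso)
  note cancel = H1.endo.A.iso_cancel_left[OF this, of "AMap H1 \<theta> \<cdot> \<theta>" "Comult H1 b \<cdot> \<theta>"]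
  have "AMap H2 (t b \<cdot> \<theta>) \<cdot> (t b \<cdot> \<theta>) = Comult H2 b \<cdot> (t b \<cdot> \<theta>) \<longleftrightarrow>
      AMap H1 \<theta> \<cdot> \<theta> = Comult H1 b \<cdot> \<theta>"
    unfolding l r using cancel by auto
  with counit' show ?thesis
    by (simp add: hom_iff)
qed simp

text \<open>An isomorphism of comonads identifies their categories of comodules, so the two functors in
  the next theorem differ by an isomorphism of categories. This is expressed elementwise.\<close>

theorem equivalence_iff_equivalence:
  assumes K1: "comodule_functor A B L H1 K1" and K2: "comodule_functor A B L H2 K2"
    and str: "\<And>a. a \<in> Obj A \<Longrightarrow> structure_of K2 a = t (OMap L a) \<cdot> structure_of K1 a"
  shows "equivalence A (Comodules B H1) K1 \<longleftrightarrow> equivalence A (Comodules B H2) K2"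
proof -
  interpret K1: comodule_functor A B L H1 K1 by fact
  interpret K2: comodule_functor A B L H2 K2 by fact
  \<comment> \<open>Compatibility with the two structures is the same condition, whatever the target.\<close>
  have compat: "(t b \<cdot> \<theta>) \<cdot> g = AMap H2 g \<cdot> K2.\<beta> a \<longleftrightarrow> \<theta> \<cdot> g = AMap H1 g \<cdot> K1.\<beta> a"
    if a [simp]: "a \<in> Obj A" and g: "g \<in> hom B (OMap L a) b" and \<theta>: "\<theta> \<in> hom B b (OMap H1 b)" for a b g \<theta>
  proof -
    note [simp] = g[unfolded hom_iff] \<theta>[unfolded hom_iff]
    have b [simp]: "b \<in> Obj B" using H1.endo.A.cod_closed[of g] by simp
    have "AMap H2 g \<cdot> K2.\<beta> a = (AMap H2 g \<cdot> t (OMap L a)) \<cdot> K1.\<beta> a"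
      by (simp add: str H1.endo.A.assoc)
    also have "AMap H2 g \<cdot> t (OMap L a) = t b \<cdot> AMap H1 g"
      using naturality[OF g] by simp
    finally have "AMap H2 g \<cdot> K2.\<beta> a = t b \<cdot> (AMap H1 g \<cdot> K1.\<beta> a)"
      by (simp add: H1.endo.A.assoc)
    moreover have "(t b \<cdot> \<theta>) \<cdot> g = t b \<cdot> (\<theta> \<cdot> g)" by (simp add: H1.endo.A.assoc)
    ultimately show ?thesis
      using H1.endo.A.iso_cancel_left[OF component_iso[OF b], of "\<theta> \<cdot> g" "AMap H1 g \<cdot> K1.\<beta> a"] by auto
  qed
  have "fully_faithful A (Comodules B H1) K1 \<longleftrightarrow> fully_faithful A (Comodules B H2) K2"
    unfolding K1.fully_faithful_iff K2.fully_faithful_iff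
  proof (intro ball_cong refl)
    fix a b assume a: "a \<in> Obj A" and b: "b \<in> Obj A"
    have "{g \<in> hom B (OMap L a) (OMap L b). K1.\<beta> b \<cdot> g = AMap H1 g \<cdot> K1.\<beta> a} =
        {g \<in> hom B (OMap L a) (OMap L b). K2.\<beta> b \<cdot> g = AMap H2 g \<cdot> K2.\<beta> a}"
      using compat[OF a, of _ "OMap L b" "K1.\<beta> b"] b by (auto simp: str hom_iff[of "K1.\<beta> b"])
    then show "bij_betw (AMap L) (hom A a b)
          {g \<in> hom B (OMap L a) (OMap L b). K1.\<beta> b \<cdot> g = AMap H1 g \<cdot> K1.\<beta> a} \<longleftrightarrow>
        bij_betw (AMap L) (hom A a b)
          {g \<in> hom B (OMap L a) (OMap L b). K2.\<beta> b \<cdot> g = AMap H2 g \<cdot> K2.\<beta> a}" by simp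
  qed
  moreover have "essentially_surjective A (Comodules B H1) K1 \<longleftrightarrow>
      essentially_surjective A (Comodules B H2) K2"
    unfolding K1.essentially_surjective_iff K2.essentially_surjective_iff
  proof (intro iffI allI impI)
    fix b \<theta>
    assume *: "\<forall>b \<theta>. (b, \<theta>) \<in> Obj (Comodules B H2) \<longrightarrow> (\<exists>a\<in>Obj A. \<exists>k\<in>hom B (OMap L a) b.
        iso B k \<and> \<theta> \<cdot> k = AMap H2 k \<cdot> K2.\<beta> a)"
      and obj: "(b, \<theta>) \<in> Obj (Comodules B H1)"
    then have \<theta>: "\<theta> \<in> hom B b (OMap H1 b)" by simp
    with obj have "(b, t b \<cdot> \<theta>) \<in> Obj (Comodules B H2)" using comodule_iff by blast
    with * obtain a k where "a \<in> Obj A" "k \<in> hom B (OMap L a) b" "iso B k"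
        "(t b \<cdot> \<theta>) \<cdot> k = AMap H2 k \<cdot> K2.\<beta> a" by blast
    with compat[OF _ _ \<theta>] show "\<exists>a\<in>Obj A. \<exists>k\<in>hom B (OMap L a) b.
        iso B k \<and> \<theta> \<cdot> k = AMap H1 k \<cdot> K1.\<beta> a" by blast
  next
    fix b \<kappa>
    assume *: "\<forall>b \<theta>. (b, \<theta>) \<in> Obj (Comodules B H1) \<longrightarrow> (\<exists>a\<in>Obj A. \<exists>k\<in>hom B (OMap L a) b.
        iso B k \<and> \<theta> \<cdot> k = AMap H1 k \<cdot> K1.\<beta> a)"
      and obj: "(b, \<kappa>) \<in> Obj (Comodules B H2)"
    then have [simp]: "b \<in> Obj B" "\<kappa> \<in> Arr B" "Dom B \<kappa> = b" "Cod B \<kappa> = OMap H2 b"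
      by (auto simp: hom_iff)
    obtain s where s: "s \<in> hom B (OMap H2 b) (OMap H1 b)" "t b \<cdot> s = Ide B (OMap H2 b)"
      using H1.endo.A.iso_obtain_inverse[OF component_iso component, of b] by auto
    define \<theta> where "\<theta> = s \<cdot> \<kappa>"
    have \<theta>: "\<theta> \<in> hom B b (OMap H1 b)" using s(1) by (simp add: \<theta>_def hom_iff)
    have \<kappa>: "\<kappa> = t b \<cdot> \<theta>" using s by (simp add: \<theta>_def hom_iff flip: H1.endo.A.assoc)
    with obj have "(b, \<theta>) \<in> Obj (Comodules B H1)" using comodule_iff[OF \<theta>] by simp
    with * obtain a k where "a \<in> Obj A" "k \<in> hom B (OMap L a) b" "iso B k"
        "\<theta> \<cdot> k = AMap H1 k \<cdot> K1.\<beta> a" by blast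
    with compat[OF _ _ \<theta>] show "\<exists>a\<in>Obj A. \<exists>k\<in>hom B (OMap L a) b.
        iso B k \<and> \<kappa> \<cdot> k = AMap H2 k \<cdot> K2.\<beta> a" unfolding \<kappa> by blast
  qed
  ultimately show ?thesis
    using equivalence_iff K1.K.cat_functor_axioms K2.K.cat_functor_axioms by blast
qed

end

section \<open>Left adjoints with a coaction\<close>

lemma adj_comonad_simps [simp]:
  "OMap (adj_comonad L R \<eta> \<epsilon>) b = OMap L (OMap R b)"
  "AMap (adj_comonad L R \<eta> \<epsilon>) f = AMap L (AMap R f)"
  "Comult (adj_comonad L R \<eta> \<epsilon>) b = AMap L (\<eta> (OMap R b))"
  "Counit (adj_comonad L R \<eta> \<epsilon>) = \<epsilon>"
  by (simp_all add: adj_comonad_def)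

lemma comonad_comparison_simps [simp]:
  "OMap (comonad_comparison A L \<eta>) a = (OMap L a, AMap L (\<eta> a))"
  "AMap (comonad_comparison A L \<eta>) f =
     ((OMap L (Dom A f), AMap L (\<eta> (Dom A f))), AMap L f, (OMap L (Cod A f), AMap L (\<eta> (Cod A f))))"
  by (simp_all add: comonad_comparison_def Let_def)

context adjunction
begin

abbreviation W :: "('p, 'n) comonad" where "W \<equiv> adj_comonad L R \<eta> \<epsilon>"

lemma unit_natural: "f \<in> Arr A \<Longrightarrow> \<eta> (Cod A f) \<cdot>\<^bsub>A\<^esub> f = AMap R (AMap L f) \<cdot>\<^bsub>A\<^esub> \<eta> (Dom A f)"
  using unit.natural[of f] by simp

lemma counit_natural: "g \<in> Arr B \<Longrightarrow> \<epsilon> (Cod B g) \<cdot>\<^bsub>B\<^esub> AMap L (AMap R g) = g \<cdot>\<^bsub>B\<^esub> \<epsilon> (Dom B g)"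
  using counit.natural[of g] by simp

text \<open>Together, the next three facts give the bijection between arrows \<open>L a \<rightarrow> b\<close> and arrows \<open>a \<rightarrow> R b\<close>.\<close>

lemma transpose_in_hom: "a \<in> Obj A \<Longrightarrow> x \<in> hom B (OMap L a) b \<Longrightarrow> AMap R x \<cdot>\<^bsub>A\<^esub> \<eta> a \<in> hom A a (OMap R b)"
  by (auto simp: hom_iff)

lemma transpose_counit:
  assumes a: "a \<in> Obj A" and x: "x \<in> hom B (OMap L a) b"
  shows "\<epsilon> b \<cdot>\<^bsub>B\<^esub> AMap L (AMap R x \<cdot>\<^bsub>A\<^esub> \<eta> a) = x"
proof -
  note [simp] = a x[unfolded hom_iff]
  have [simp]: "b \<in> Obj B" using left.B.cod_closed[of x] by simp
  have "\<epsilon> b \<cdot>\<^bsub>B\<^esub> AMap L (AMap R x \<cdot>\<^bsub>A\<^esub> \<eta> a) = (\<epsilon> b \<cdot>\<^bsub>B\<^esub> AMap L (AMap R x)) \<cdot>\<^bsub>B\<^esub> AMap L (\<eta> a)"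
    by (simp add: left.comp left.B.assoc)
  also have "\<dots> = (x \<cdot>\<^bsub>B\<^esub> \<epsilon> (OMap L a)) \<cdot>\<^bsub>B\<^esub> AMap L (\<eta> a)"
    using counit_natural[of x] by simp
  also have "\<dots> = x" by (simp add: left.B.assoc triangle_left)
  finally show ?thesis .
qed

lemma transpose_unique:
  assumes f: "f \<in> hom A a (OMap R b)" and g: "g \<in> hom A a (OMap R b)" and b: "b \<in> Obj B"
    and eq: "\<epsilon> b \<cdot>\<^bsub>B\<^esub> AMap L f = \<epsilon> b \<cdot>\<^bsub>B\<^esub> AMap L g"
  shows "f = g"
proof -
  have *: "AMap R (\<epsilon> b \<cdot>\<^bsub>B\<^esub> AMap L f) \<cdot>\<^bsub>A\<^esub> \<eta> a = f" if f: "f \<in> hom A a (OMap R b)" for f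
  proof -
    note [simp] = f[unfolded hom_iff] b
    have [simp]: "a \<in> Obj A" using left.A.dom_closed[of f] by simp
    have "AMap R (\<epsilon> b \<cdot>\<^bsub>B\<^esub> AMap L f) \<cdot>\<^bsub>A\<^esub> \<eta> a = AMap R (\<epsilon> b) \<cdot>\<^bsub>A\<^esub> (AMap R (AMap L f) \<cdot>\<^bsub>A\<^esub> \<eta> a)"
      by (simp add: right.comp left.A.assoc)
    also have "\<dots> = AMap R (\<epsilon> b) \<cdot>\<^bsub>A\<^esub> (\<eta> (OMap R b) \<cdot>\<^bsub>A\<^esub> f)"
      using unit_natural[of f] by simp
    also have "\<dots> = f" by (simp add: triangle_right flip: left.A.assoc)
    finally show ?thesis .
  qed
  show ?thesis using *[OF g] unfolding eq[symmetric] *[OF f] .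
qed

lemma comonad_W: "comonad B W"
proof
  fix b assume [simp]: "b \<in> Obj B"
  show "OMap W b \<in> Obj B" by simp
  show "AMap W (Ide B b) = Ide B (OMap W b)" by simp
  show "Comult W b \<in> hom B (OMap W b) (OMap (W \<circ>\<circ> W) b)" by (simp add: hom_iff)
  show "Counit W b \<in> hom B (OMap W b) (OMap id_ftr b)" by (simp add: hom_iff)
  show "AMap W (Comult W b) \<cdot>\<^bsub>B\<^esub> Comult W b = Comult W (OMap W b) \<cdot>\<^bsub>B\<^esub> Comult W b"
    using unit_natural[of "\<eta> (OMap R b)"] by (simp flip: left.comp)
  show "Counit W (OMap W b) \<cdot>\<^bsub>B\<^esub> Comult W b = Ide B (OMap W b)"
    by (simp add: triangle_left)
  show "AMap W (Counit W b) \<cdot>\<^bsub>B\<^esub> Comult W b = Ide B (OMap W b)"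
    by (simp add: triangle_right flip: left.comp)
next
  fix f a b assume "f \<in> hom B a b"
  then have [simp]: "f \<in> Arr B" "Dom B f = a" "Cod B f = b" "a \<in> Obj B" "b \<in> Obj B"
    by (auto simp: hom_iff)
  show "AMap W f \<in> hom B (OMap W a) (OMap W b)" by (simp add: hom_iff)
  show "Comult W b \<cdot>\<^bsub>B\<^esub> AMap W f = AMap (W \<circ>\<circ> W) f \<cdot>\<^bsub>B\<^esub> Comult W a"
    using unit_natural[of "AMap R f"] by (simp flip: left.comp)
  show "Counit W b \<cdot>\<^bsub>B\<^esub> AMap W f = AMap id_ftr f \<cdot>\<^bsub>B\<^esub> Counit W a"
    using counit_natural[of f] by simp
qed (auto simp: left.comp right.comp hom_iff)

lemma comodule_functor_comparison: "comodule_functor A B L W (comonad_comparison A L \<eta>)"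
proof -
  interpret W: comonad B W by (rule comonad_W)
  interpret C: category "Comodules B W" by (rule category_Comodules) (rule W.endo.cat_functor_axioms)
  have obj: "OMap (comonad_comparison A L \<eta>) a \<in> Obj (Comodules B W)" if a [simp]: "a \<in> Obj A" for a
    using unit_natural[of "\<eta> a"] by (simp add: hom_iff triangle_left flip: left.comp)
  show ?thesis
  proof
    fix f a b assume f: "f \<in> hom A a b"
    then show "AMap (comonad_comparison A L \<eta>) f \<in> hom (Comodules B W)
        (OMap (comonad_comparison A L \<eta>) a) (OMap (comonad_comparison A L \<eta>) b)"
      using obj[of a] obj[of b] unit_natural[of f]
      by (auto simp: hom_iff simp flip: left.comp)
  next
    fix f a b g c assume "f \<in> hom A a b" "g \<in> hom A b c"
    then show "AMap (comonad_comparison A L \<eta>) (g \<cdot>\<^bsub>A\<^esub> f) =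
        AMap (comonad_comparison A L \<eta>) g \<cdot>\<^bsub>Comodules B W\<^esub> AMap (comonad_comparison A L \<eta>) f"
      by (auto simp: hom_iff left.comp)
  next
    show "eq_ftr A (forget \<circ>\<circ> comonad_comparison A L \<eta>) L" by (simp add: eq_ftr_def)
  qed (use obj in simp_all)
qed

end

locale adjoint_comodule_functor = adjunction A B L R \<eta> \<epsilon> + comodule_functor A B L H K
  for A :: "('o, 'm) category" and B :: "('p, 'n) category"
    and L :: "('o, 'm, 'p, 'n) ftr" and R :: "('p, 'n, 'o, 'm) ftr"
    and \<eta> :: "'o \<Rightarrow> 'm" and \<epsilon> :: "'p \<Rightarrow> 'n"
    and H :: "('p, 'n) comonad" and K :: "('o, 'm, ('p, 'n) em_obj, ('p, 'n) em_arr) ftr"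
begin

text \<open>This transformation is the morphism of comonads \<open>LR \<rightarrow> H\<close> that corresponds to the coaction of \<open>H\<close> on \<open>L\<close>.\<close>

definition canonical :: "'p \<Rightarrow> 'n" where
  "canonical b = AMap H (\<epsilon> b) \<cdot>\<^bsub>B\<^esub> \<beta> (OMap R b)"

lemma canonical_simps [simp]:
  assumes "b \<in> Obj B"
  shows "canonical b \<in> Arr B" "Dom B (canonical b) = OMap L (OMap R b)" "Cod B (canonical b) = OMap H b"
  using assms by (simp_all add: canonical_def)

lemma canonical_natural:
  assumes f: "f \<in> hom B b c"
  shows "canonical c \<cdot>\<^bsub>B\<^esub> AMap L (AMap R f) = AMap H f \<cdot>\<^bsub>B\<^esub> canonical b"
proof -
  note [simp] = f[unfolded hom_iff]
  have [simp]: "b \<in> Obj B" "c \<in> Obj B" using left.B.dom_closed[of f] left.B.cod_closed[of f] by simp_all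
  have "canonical c \<cdot>\<^bsub>B\<^esub> AMap L (AMap R f) = AMap H (\<epsilon> c) \<cdot>\<^bsub>B\<^esub> (\<beta> (OMap R c) \<cdot>\<^bsub>B\<^esub> AMap L (AMap R f))"
    by (simp add: canonical_def left.B.assoc)
  also have "\<beta> (OMap R c) \<cdot>\<^bsub>B\<^esub> AMap L (AMap R f) = AMap H (AMap L (AMap R f)) \<cdot>\<^bsub>B\<^esub> \<beta> (OMap R b)"
    by (rule coaction_natural) (simp add: hom_iff)
  also have "AMap H (\<epsilon> c) \<cdot>\<^bsub>B\<^esub> (AMap H (AMap L (AMap R f)) \<cdot>\<^bsub>B\<^esub> \<beta> (OMap R b)) =
      AMap H (\<epsilon> c \<cdot>\<^bsub>B\<^esub> AMap L (AMap R f)) \<cdot>\<^bsub>B\<^esub> \<beta> (OMap R b)"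
    by (simp add: H.endo.comp left.B.assoc)
  also have "\<dots> = AMap H (f \<cdot>\<^bsub>B\<^esub> \<epsilon> b) \<cdot>\<^bsub>B\<^esub> \<beta> (OMap R b)"
    using counit_natural[of f] by simp
  also have "\<dots> = AMap H f \<cdot>\<^bsub>B\<^esub> canonical b"
    by (simp add: canonical_def H.endo.comp left.B.assoc)
  finally show ?thesis .
qed

lemma canonical_counit:
  assumes b [simp]: "b \<in> Obj B"
  shows "Counit H b \<cdot>\<^bsub>B\<^esub> canonical b = \<epsilon> b"
proof -
  have "Counit H b \<cdot>\<^bsub>B\<^esub> canonical b = (Counit H b \<cdot>\<^bsub>B\<^esub> AMap H (\<epsilon> b)) \<cdot>\<^bsub>B\<^esub> \<beta> (OMap R b)"
    by (simp add: canonical_def left.B.assoc)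
  also have "\<dots> = (\<epsilon> b \<cdot>\<^bsub>B\<^esub> Counit H (OMap L (OMap R b))) \<cdot>\<^bsub>B\<^esub> \<beta> (OMap R b)"
    using H.counit.natural[of "\<epsilon> b"] by simp
  also have "\<dots> = \<epsilon> b" by (simp add: left.B.assoc coaction_counit)
  finally show ?thesis .
qed

text \<open>Maps into a cofree comodule are determined by their composite with the counit. So this and
\<open>canonical_counit\<close> characterize \<open>canonical b\<close> as the comodule map from \<open>K (R b)\<close> to the cofree comodule
on \<open>b\<close> that lies over \<open>\<epsilon>\<^sub>b\<close>.\<close>

lemma canonical_coaction:
  assumes b [simp]: "b \<in> Obj B"
  shows "Comult H b \<cdot>\<^bsub>B\<^esub> canonical b = AMap H (canonical b) \<cdot>\<^bsub>B\<^esub> \<beta> (OMap R b)"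
proof -
  have "Comult H b \<cdot>\<^bsub>B\<^esub> canonical b = (Comult H b \<cdot>\<^bsub>B\<^esub> AMap H (\<epsilon> b)) \<cdot>\<^bsub>B\<^esub> \<beta> (OMap R b)"
    by (simp add: canonical_def left.B.assoc)
  also have "\<dots> = (AMap H (AMap H (\<epsilon> b)) \<cdot>\<^bsub>B\<^esub> Comult H (OMap L (OMap R b))) \<cdot>\<^bsub>B\<^esub> \<beta> (OMap R b)"
    using H.comult.natural[of "\<epsilon> b"] by simp
  also have "\<dots> = AMap H (AMap H (\<epsilon> b)) \<cdot>\<^bsub>B\<^esub> (Comult H (OMap L (OMap R b)) \<cdot>\<^bsub>B\<^esub> \<beta> (OMap R b))"
    by (simp add: left.B.assoc)
  also have "\<dots> = AMap H (AMap H (\<epsilon> b)) \<cdot>\<^bsub>B\<^esub> (AMap H (\<beta> (OMap R b)) \<cdot>\<^bsub>B\<^esub> \<beta> (OMap R b))"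
    by (simp add: coaction_coassoc)
  also have "\<dots> = AMap H (canonical b) \<cdot>\<^bsub>B\<^esub> \<beta> (OMap R b)"
    by (simp add: canonical_def H.endo.comp left.B.assoc)
  finally show ?thesis .
qed

text \<open>Hence \<open>canonical\<close> carries the coaction \<open>L \<eta>\<close> of the comparison functor to the coaction of \<open>K\<close>, and
\<open>canonical_coaction\<close> becomes compatibility with the comultiplications.\<close>

lemma canonical_unit:
  assumes a [simp]: "a \<in> Obj A"
  shows "canonical (OMap L a) \<cdot>\<^bsub>B\<^esub> AMap L (\<eta> a) = \<beta> a"
proof -
  have "canonical (OMap L a) \<cdot>\<^bsub>B\<^esub> AMap L (\<eta> a) =
      AMap H (\<epsilon> (OMap L a)) \<cdot>\<^bsub>B\<^esub> (\<beta> (OMap R (OMap L a)) \<cdot>\<^bsub>B\<^esub> AMap L (\<eta> a))"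
    by (simp add: canonical_def left.B.assoc)
  also have "\<beta> (OMap R (OMap L a)) \<cdot>\<^bsub>B\<^esub> AMap L (\<eta> a) = AMap H (AMap L (\<eta> a)) \<cdot>\<^bsub>B\<^esub> \<beta> a"
    by (rule coaction_natural) (simp add: hom_iff)
  also have "AMap H (\<epsilon> (OMap L a)) \<cdot>\<^bsub>B\<^esub> (AMap H (AMap L (\<eta> a)) \<cdot>\<^bsub>B\<^esub> \<beta> a) =
      AMap H (\<epsilon> (OMap L a) \<cdot>\<^bsub>B\<^esub> AMap L (\<eta> a)) \<cdot>\<^bsub>B\<^esub> \<beta> a"
    by (simp add: H.endo.comp left.B.assoc)
  also have "\<dots> = \<beta> a" by (simp add: triangle_left)
  finally show ?thesis .
qed

lemma comonad_iso_canonical: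
  assumes "\<And>b. b \<in> Obj B \<Longrightarrow> iso B (canonical b)"
  shows "comonad_iso B W H canonical"
proof -
  interpret W: comonad B W by (rule comonad_W)
  show ?thesis
  proof
    fix b assume [simp]: "b \<in> Obj B"
    show "canonical b \<in> hom B (OMap W b) (OMap H b)" by (simp add: hom_iff)
    show "Counit H b \<cdot>\<^bsub>B\<^esub> canonical b = Counit W b" by (simp add: canonical_counit)
    show "Comult H b \<cdot>\<^bsub>B\<^esub> canonical b = AMap H (canonical b) \<cdot>\<^bsub>B\<^esub> canonical (OMap W b) \<cdot>\<^bsub>B\<^esub> Comult W b"
      by (simp add: canonical_coaction canonical_unit)
    show "iso B (canonical b)" by (rule assms) simp
  next
    fix f b c assume "f \<in> hom B b c"
    then show "canonical c \<cdot>\<^bsub>B\<^esub> AMap W f = AMap H f \<cdot>\<^bsub>B\<^esub> canonical b"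
      using canonical_natural by simp
  qed
qed

text \<open>Since \<open>K\<close> is essentially surjective, the cofree comodule on \<open>b\<close> is \<open>K r\<close> for some \<open>r\<close>, up to an
isomorphism \<open>k\<close>. The arrow \<open>p : r \<rightarrow> R b\<close> is the transpose of the counit composed with \<open>k\<close>, and
\<open>q : R b \<rightarrow> r\<close> is obtained from \<open>canonical b\<close> by fullness. They are inverse to each other because both
\<open>r\<close> and \<open>R b\<close> represent maps \<open>L a \<rightarrow> b\<close>, and \<open>canonical b = k \<cdot> L q\<close>.\<close>

lemma iso_canonical_if_equivalence:
  assumes eqv: "equivalence A (Comodules B H) K" and b [simp]: "b \<in> Obj B"
  shows "iso B (canonical b)"
proof -
  have ff: "bij_betw (AMap L) (hom A a c)
      {g \<in> hom B (OMap L a) (OMap L c). \<beta> c \<cdot>\<^bsub>B\<^esub> g = AMap H g \<cdot>\<^bsub>B\<^esub> \<beta> a}"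
    if "a \<in> Obj A" "c \<in> Obj A" for a c
    using equivalence_imp_fully_faithful[OF eqv] that unfolding fully_faithful_iff by blast
  have "(OMap H b, Comult H b) \<in> Obj (Comodules B H)"
    by (simp add: hom_iff H.counit_left H.comult_coassoc)
  then obtain r k where r [simp]: "r \<in> Obj A" and k: "k \<in> hom B (OMap L r) (OMap H b)" and "iso B k"
      and k_comod: "Comult H b \<cdot>\<^bsub>B\<^esub> k = AMap H k \<cdot>\<^bsub>B\<^esub> \<beta> r"
    using equivalence_imp_essentially_surjective[OF eqv] unfolding essentially_surjective_iff by blast
  note [simp] = k[unfolded hom_iff]
  obtain k' where k': "k' \<in> hom B (OMap H b) (OMap L r)"
      "k' \<cdot>\<^bsub>B\<^esub> k = Ide B (OMap L r)" "k \<cdot>\<^bsub>B\<^esub> k' = Ide B (OMap H b)"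
    using left.B.iso_obtain_inverse[OF \<open>iso B k\<close> k] by blast
  note [simp] = k'(1)[unfolded hom_iff]
  have k'k [simp]: "k' \<cdot>\<^bsub>B\<^esub> (k \<cdot>\<^bsub>B\<^esub> x) = x" if "x \<in> Arr B" "Cod B x = OMap L r" for x
    using that k'(2) by (simp flip: left.B.assoc)
  have kk' [simp]: "k \<cdot>\<^bsub>B\<^esub> (k' \<cdot>\<^bsub>B\<^esub> x) = x" if "x \<in> Arr B" "Cod B x = OMap H b" for x
    using that k'(3) by (simp flip: left.B.assoc)
  define p where "p = AMap R (Counit H b \<cdot>\<^bsub>B\<^esub> k) \<cdot>\<^bsub>A\<^esub> \<eta> r"
  have p: "p \<in> hom A r (OMap R b)" and \<epsilon>p: "\<epsilon> b \<cdot>\<^bsub>B\<^esub> AMap L p = Counit H b \<cdot>\<^bsub>B\<^esub> k"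
    unfolding p_def by (auto intro!: transpose_in_hom transpose_counit simp: hom_iff)
  note [simp] = p[unfolded hom_iff]
  \<comment> \<open>A comodule map into the cofree comodule on \<open>b\<close> can be recovered from its composite with the counit.\<close>
  have cofree_unique: "u = u'"
    if "u \<in> hom B (OMap L a) (OMap H b)" "Comult H b \<cdot>\<^bsub>B\<^esub> u = AMap H u \<cdot>\<^bsub>B\<^esub> \<beta> a" "a \<in> Obj A"
      "u' = AMap H (Counit H b \<cdot>\<^bsub>B\<^esub> u) \<cdot>\<^bsub>B\<^esub> \<beta> a" for u u' a
  proof -
    note [simp] = that(1)[unfolded hom_iff] that(3)
    have "u' = AMap H (Counit H b) \<cdot>\<^bsub>B\<^esub> (Comult H b \<cdot>\<^bsub>B\<^esub> u)"
      unfolding that(2,4) by (simp add: H.endo.comp left.B.assoc)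
    then show ?thesis by (simp add: H.counit_right flip: left.B.assoc)
  qed
  have tp_comod: "Comult H b \<cdot>\<^bsub>B\<^esub> (canonical b \<cdot>\<^bsub>B\<^esub> AMap L p) = AMap H (canonical b \<cdot>\<^bsub>B\<^esub> AMap L p) \<cdot>\<^bsub>B\<^esub> \<beta> r"
  proof -
    have "Comult H b \<cdot>\<^bsub>B\<^esub> (canonical b \<cdot>\<^bsub>B\<^esub> AMap L p) =
        AMap H (canonical b) \<cdot>\<^bsub>B\<^esub> (\<beta> (OMap R b) \<cdot>\<^bsub>B\<^esub> AMap L p)"
      by (simp add: canonical_coaction left.B.assoc flip: left.B.assoc[of _ "canonical b"])
    then show ?thesis
      by (simp add: coaction_natural[OF p] H.endo.comp left.B.assoc)
  qed
  have "Counit H b \<cdot>\<^bsub>B\<^esub> (canonical b \<cdot>\<^bsub>B\<^esub> AMap L p) = Counit H b \<cdot>\<^bsub>B\<^esub> k"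
    by (simp add: canonical_counit flip: left.B.assoc \<epsilon>p)
  then have tp: "canonical b \<cdot>\<^bsub>B\<^esub> AMap L p = k"
    using cofree_unique[OF _ tp_comod] cofree_unique[OF k k_comod] by (simp add: hom_iff)
  \<comment> \<open>It remains to see that \<open>k' \<cdot> canonical b\<close> is a comodule map \<open>K (R b) \<rightarrow> K r\<close>, so that \<open>K\<close> lifts it.\<close>
  define g where "g = k' \<cdot>\<^bsub>B\<^esub> canonical b"
  have kg: "k \<cdot>\<^bsub>B\<^esub> g = canonical b" by (simp add: g_def)
  have g: "g \<in> hom B (OMap L (OMap R b)) (OMap L r)" by (simp add: g_def hom_iff)
  note [simp] = g[unfolded hom_iff]
  have Hk: "iso B (AMap H k)" using \<open>iso B k\<close> by (rule H.endo.map_iso)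
  have "AMap H k \<cdot>\<^bsub>B\<^esub> (\<beta> r \<cdot>\<^bsub>B\<^esub> g) = (AMap H k \<cdot>\<^bsub>B\<^esub> \<beta> r) \<cdot>\<^bsub>B\<^esub> g"
    by (simp add: left.B.assoc)
  also have "\<dots> = Comult H b \<cdot>\<^bsub>B\<^esub> (k \<cdot>\<^bsub>B\<^esub> g)" by (simp add: left.B.assoc flip: k_comod)
  also have "\<dots> = AMap H (k \<cdot>\<^bsub>B\<^esub> g) \<cdot>\<^bsub>B\<^esub> \<beta> (OMap R b)" by (simp add: kg canonical_coaction)
  also have "\<dots> = AMap H k \<cdot>\<^bsub>B\<^esub> (AMap H g \<cdot>\<^bsub>B\<^esub> \<beta> (OMap R b))" by (simp add: H.endo.comp left.B.assoc)
  finally have "\<beta> r \<cdot>\<^bsub>B\<^esub> g = AMap H g \<cdot>\<^bsub>B\<^esub> \<beta> (OMap R b)"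
    by (rule left.B.iso_cancel_left[OF Hk, rotated 4]) simp_all
  then have "g \<in> AMap L ` hom A (OMap R b) r"
    using bij_betw_imp_surj_on[OF ff[of "OMap R b" r]] g by simp
  then obtain q where q: "q \<in> hom A (OMap R b) r" and Lq: "AMap L q = g" by blast
  note [simp] = q[unfolded hom_iff]
  have "AMap L (q \<cdot>\<^bsub>A\<^esub> p) = AMap L (Ide A r)"
    using tp k'(2) by (simp add: left.comp Lq g_def left.B.assoc)
  then have qp: "q \<cdot>\<^bsub>A\<^esub> p = Ide A r"
    using bij_betw_imp_inj_on[OF ff[of r r]] by (auto simp: inj_on_def hom_iff)
  have "canonical b \<cdot>\<^bsub>B\<^esub> AMap L (p \<cdot>\<^bsub>A\<^esub> q) = (canonical b \<cdot>\<^bsub>B\<^esub> AMap L p) \<cdot>\<^bsub>B\<^esub> AMap L q"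
    by (simp add: left.comp left.B.assoc)
  also have "\<dots> = canonical b" by (simp add: tp Lq kg)
  finally have "Counit H b \<cdot>\<^bsub>B\<^esub> (canonical b \<cdot>\<^bsub>B\<^esub> AMap L (p \<cdot>\<^bsub>A\<^esub> q)) = \<epsilon> b"
    by (simp add: canonical_counit)
  then have "\<epsilon> b \<cdot>\<^bsub>B\<^esub> AMap L (p \<cdot>\<^bsub>A\<^esub> q) = \<epsilon> b \<cdot>\<^bsub>B\<^esub> AMap L (Ide A (OMap R b))"
    by (simp add: canonical_counit flip: left.B.assoc)
  then have pq: "p \<cdot>\<^bsub>A\<^esub> q = Ide A (OMap R b)"
    by (rule transpose_unique[of _ "OMap R b" b, rotated 3]) (simp_all add: hom_iff)
  have "iso A q" using left.A.isoI[OF q p pq qp] .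
  then have "iso B (k \<cdot>\<^bsub>B\<^esub> AMap L q)"
    using \<open>iso B k\<close> by (intro left.B.iso_comp left.map_iso) simp_all
  then show ?thesis by (simp add: Lq kg)
qed

theorem equivalence_iff_canonical_iso:
  "equivalence A (Comodules B H) K \<longleftrightarrow>
    (\<forall>b\<in>Obj B. iso B (canonical b)) \<and> equivalence A (Comodules B W) (comonad_comparison A L \<eta>)"
proof -
  have "equivalence A (Comodules B W) (comonad_comparison A L \<eta>) \<longleftrightarrow> equivalence A (Comodules B H) K"
    if "\<forall>b\<in>Obj B. iso B (canonical b)"
  proof -
    interpret comonad_iso B W H canonical
      by (rule comonad_iso_canonical) (use that in blast)
    show ?thesis
      by (rule equivalence_iff_equivalence[OF comodule_functor_comparison comodule_functor_axioms])
        (simp add: canonical_unit structure_of_def)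
  qed
  then show ?thesis using iso_canonical_if_equivalence by blast
qed

end

section \<open>The free and cofree adjunctions\<close>

lemma free_simps [simp]:
  "OMap (free A T) a = (OMap T a, Mult T a)"
  "AMap (free A T) f = ((OMap T (Dom A f), Mult T (Dom A f)), AMap T f, (OMap T (Cod A f), Mult T (Cod A f)))"
  "free_counit A T x = ((OMap T (fst x), Mult T (fst x)), snd x, x)"
  by (simp_all add: free_def free_counit_def Let_def split_beta)

lemma cofree_simps [simp]:
  "OMap (cofree A G) a = (OMap G a, Comult G a)"
  "AMap (cofree A G) f =
     ((OMap G (Dom A f), Comult G (Dom A f)), AMap G f, (OMap G (Cod A f), Comult G (Cod A f)))"
  "cofree_unit A G x = (x, snd x, (OMap G (fst x), Comult G (fst x)))"
  by (simp_all add: cofree_def cofree_unit_def Let_def split_beta)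

lemma adjunctionI:
  assumes L: "cat_functor A B L" and R: "cat_functor B A R"
    and "\<And>a. a \<in> Obj A \<Longrightarrow> \<eta> a \<in> hom A a (OMap R (OMap L a))"
    and "\<And>f a b. f \<in> hom A a b \<Longrightarrow> \<eta> b \<cdot>\<^bsub>A\<^esub> f = AMap R (AMap L f) \<cdot>\<^bsub>A\<^esub> \<eta> a"
    and "\<And>b. b \<in> Obj B \<Longrightarrow> \<epsilon> b \<in> hom B (OMap L (OMap R b)) b"
    and "\<And>f a b. f \<in> hom B a b \<Longrightarrow> \<epsilon> b \<cdot>\<^bsub>B\<^esub> AMap L (AMap R f) = f \<cdot>\<^bsub>B\<^esub> \<epsilon> a"
    and "\<And>a. a \<in> Obj A \<Longrightarrow> \<epsilon> (OMap L a) \<cdot>\<^bsub>B\<^esub> AMap L (\<eta> a) = Ide B (OMap L a)"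
    and "\<And>b. b \<in> Obj B \<Longrightarrow> AMap R (\<epsilon> b) \<cdot>\<^bsub>A\<^esub> \<eta> (OMap R b) = Ide A (OMap R b)"
  shows "adjunction A B L R \<eta> \<epsilon>"
proof -
  interpret L: cat_functor A B L by fact
  interpret R: cat_functor B A R by fact
  show ?thesis
    by (intro adjunction.intro nat_trans.intro nat_trans_axioms.intro adjunction_axioms.intro
        cat_functor_comp[OF L R] cat_functor_comp[OF R L] cat_functor_id L R
        L.A.category_axioms L.B.category_axioms)
      (use assms in simp_all)
qed

lemma (in monad) free_object: "a \<in> Obj A \<Longrightarrow> (OMap T a, Mult T a) \<in> Obj (Modules A T)"
  by (simp add: hom_iff unit_left mult_assoc)

lemma (in monad) free_arrow:
  assumes "f \<in> hom A a b"
  shows "((OMap T a, Mult T a), AMap T f, (OMap T b, Mult T b)) \<in> Arr (Modules A T)"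
proof -
  note [simp] = assms[unfolded hom_iff]
  have "a \<in> Obj A" "b \<in> Obj A" using endo.A.dom_closed[of f] endo.A.cod_closed[of f] by simp_all
  then show ?thesis
    using free_object[of a] free_object[of b] mult.natural[of f] by (simp add: hom_iff)
qed

lemma (in monad) functor_free: "cat_functor A (Modules A T) (free A T)"
proof -
  interpret M: category "Modules A T" by (rule category_Modules) (rule endo.cat_functor_axioms)
  show ?thesis
  proof
    fix a assume a [simp]: "a \<in> Obj A"
    show "OMap (free A T) a \<in> Obj (Modules A T)" using free_object[OF a] by simp
    show "AMap (free A T) (Ide A a) = Ide (Modules A T) (OMap (free A T) a)" by simp
  next
    fix f a b assume f: "f \<in> hom A a b"
    show "AMap (free A T) f \<in> hom (Modules A T) (OMap (free A T) a) (OMap (free A T) b)"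
      using free_arrow[OF f] f by (auto simp: hom_Modules_iff hom_iff[of f])
  next
    fix f a b g c assume "f \<in> hom A a b" "g \<in> hom A b c"
    then show "AMap (free A T) (g \<cdot> f) = AMap (free A T) g \<cdot>\<^bsub>Modules A T\<^esub> AMap (free A T) f"
      by (auto simp: hom_iff endo.comp)
  qed
qed

lemma (in monad) functor_forget: "cat_functor (Modules A T) A forget"
proof -
  interpret M: category "Modules A T" by (rule category_Modules) (rule endo.cat_functor_axioms)
  show ?thesis
  proof
    fix x assume "x \<in> Obj (Modules A T)"
    then show "OMap forget x \<in> Obj A" "AMap forget (Ide (Modules A T) x) = Ide A (OMap forget x)"
      by (cases x; simp)+
  next
    fix u x y assume "u \<in> hom (Modules A T) x y"
    then show "AMap forget u \<in> hom A (OMap forget x) (OMap forget y)" by (auto simp: hom_Modules_iff)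
  next
    fix u x y v z assume "u \<in> hom (Modules A T) x y" "v \<in> hom (Modules A T) y z"
    then show "AMap forget (v \<cdot>\<^bsub>Modules A T\<^esub> u) = AMap forget v \<cdot> AMap forget u"
      by (auto simp: hom_Modules_iff)
  qed
qed

lemma (in monad) adjunction_free: "adjunction A (Modules A T) (free A T) forget (Unit T) (free_counit A T)"
proof (rule adjunctionI[OF functor_free functor_forget])
  fix a assume [simp]: "a \<in> Obj A"
  show "Unit T a \<in> hom A a (OMap forget (OMap (free A T) a))" by (simp add: hom_iff)
  show "free_counit A T (OMap (free A T) a) \<cdot>\<^bsub>Modules A T\<^esub> AMap (free A T) (Unit T a) =
      Ide (Modules A T) (OMap (free A T) a)"
    by (simp add: unit_right)
next
  fix f a b assume "f \<in> hom A a b"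
  then show "Unit T b \<cdot> f = AMap forget (AMap (free A T) f) \<cdot> Unit T a"
    using unit.naturality[of f a b] by simp
next
  fix x assume x: "x \<in> Obj (Modules A T)"
  then obtain a h where [simp]: "x = (a, h)" by (cases x)
  show "free_counit A T x \<in> hom (Modules A T) (OMap (free A T) (OMap forget x)) x"
    using free_object[of a] x by (auto simp: hom_Modules_iff)
  show "AMap forget (free_counit A T x) \<cdot> Unit T (OMap forget x) = Ide A (OMap forget x)"
    using x by simp
next
  fix u x y assume "u \<in> hom (Modules A T) x y"
  then show "free_counit A T y \<cdot>\<^bsub>Modules A T\<^esub> AMap (free A T) (AMap forget u) =
      u \<cdot>\<^bsub>Modules A T\<^esub> free_counit A T x"
    by (auto simp: hom_Modules_iff hom_iff[where A = A])
qed

lemma (in comonad) cofree_object: "a \<in> Obj A \<Longrightarrow> (OMap G a, Comult G a) \<in> Obj (Comodules A G)"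
  by (simp add: hom_iff counit_left comult_coassoc)

lemma (in comonad) cofree_arrow:
  assumes "f \<in> hom A a b"
  shows "((OMap G a, Comult G a), AMap G f, (OMap G b, Comult G b)) \<in> Arr (Comodules A G)"
proof -
  note [simp] = assms[unfolded hom_iff]
  have "a \<in> Obj A" "b \<in> Obj A" using endo.A.dom_closed[of f] endo.A.cod_closed[of f] by simp_all
  then show ?thesis
    using cofree_object[of a] cofree_object[of b] comult.natural[of f] by (simp add: hom_iff)
qed

lemma (in comonad) functor_cofree: "cat_functor A (Comodules A G) (cofree A G)"
proof -
  interpret M: category "Comodules A G" by (rule category_Comodules) (rule endo.cat_functor_axioms)
  show ?thesis
  proof
    fix a assume a [simp]: "a \<in> Obj A"
    show "OMap (cofree A G) a \<in> Obj (Comodules A G)" using cofree_object[OF a] by simp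
    show "AMap (cofree A G) (Ide A a) = Ide (Comodules A G) (OMap (cofree A G) a)" by simp
  next
    fix f a b assume f: "f \<in> hom A a b"
    show "AMap (cofree A G) f \<in> hom (Comodules A G) (OMap (cofree A G) a) (OMap (cofree A G) b)"
      using cofree_arrow[OF f] f by (auto simp: hom_Comodules_iff hom_iff[of f])
  next
    fix f a b g c assume "f \<in> hom A a b" "g \<in> hom A b c"
    then show "AMap (cofree A G) (g \<cdot> f) = AMap (cofree A G) g \<cdot>\<^bsub>Comodules A G\<^esub> AMap (cofree A G) f"
      by (auto simp: hom_iff endo.comp)
  qed
qed

lemma (in comonad) functor_forget: "cat_functor (Comodules A G) A forget"
proof -
  interpret M: category "Comodules A G" by (rule category_Comodules) (rule endo.cat_functor_axioms)
  show ?thesis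
  proof
    fix x assume "x \<in> Obj (Comodules A G)"
    then show "OMap forget x \<in> Obj A" "AMap forget (Ide (Comodules A G) x) = Ide A (OMap forget x)"
      by (cases x; simp)+
  next
    fix u x y assume "u \<in> hom (Comodules A G) x y"
    then show "AMap forget u \<in> hom A (OMap forget x) (OMap forget y)" by (auto simp: hom_Comodules_iff)
  next
    fix u x y v z assume "u \<in> hom (Comodules A G) x y" "v \<in> hom (Comodules A G) y z"
    then show "AMap forget (v \<cdot>\<^bsub>Comodules A G\<^esub> u) = AMap forget v \<cdot> AMap forget u"
      by (auto simp: hom_Comodules_iff)
  qed
qed

lemma (in comonad) adjunction_cofree:
  "adjunction (Comodules A G) A forget (cofree A G) (cofree_unit A G) (Counit G)"
proof (rule adjunctionI[OF functor_forget functor_cofree])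
  fix a assume [simp]: "a \<in> Obj A"
  show "Counit G a \<in> hom A (OMap forget (OMap (cofree A G) a)) a" by (simp add: hom_iff)
  show "AMap (cofree A G) (Counit G a) \<cdot>\<^bsub>Comodules A G\<^esub> cofree_unit A G (OMap (cofree A G) a) =
      Ide (Comodules A G) (OMap (cofree A G) a)"
    by (simp add: counit_right)
next
  fix f a b assume "f \<in> hom A a b"
  then show "Counit G b \<cdot> AMap forget (AMap (cofree A G) f) = f \<cdot> Counit G a"
    using counit.naturality[of f a b] by simp
next
  fix x assume x: "x \<in> Obj (Comodules A G)"
  then obtain a \<theta> where [simp]: "x = (a, \<theta>)" by (cases x)
  show "cofree_unit A G x \<in> hom (Comodules A G) x (OMap (cofree A G) (OMap forget x))"
    using cofree_object[of a] x by (auto simp: hom_Comodules_iff)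
  show "Counit G (OMap forget x) \<cdot> AMap forget (cofree_unit A G x) = Ide A (OMap forget x)"
    using x by simp
next
  fix u x y assume "u \<in> hom (Comodules A G) x y"
  then show "cofree_unit A G y \<cdot>\<^bsub>Comodules A G\<^esub> u =
      AMap (cofree A G) (AMap forget u) \<cdot>\<^bsub>Comodules A G\<^esub> cofree_unit A G x"
    by (auto simp: hom_Comodules_iff hom_iff[where A = A])
qed


section \<open>From free modules to all modules\<close>

text \<open>A module \<open>(a, h)\<close> is the coequalizer of the two maps \<open>T h\<close> and \<open>m\<^sub>a\<close> from the free module on \<open>T a\<close> to
the free module on \<open>a\<close>, and in the base category it is split by \<open>e\<^sub>a\<close> and the unit at \<open>T a\<close>. The
functors \<open>F\<close> and \<open>G\<close> preserve the splitting, so the inverses at the free modules induce one at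
\<open>(a, h)\<close>: it is \<open>F h \<cdot> s\<^sub>a \<cdot> G e\<^sub>a\<close>, where \<open>s\<^sub>a\<close> is the inverse at the free module on \<open>a\<close>.\<close>

lemma (in monad) iso_on_modules_if_iso_on_free_modules:
  assumes "cat_functor A C F" "cat_functor A C G"
    and t: "nat_trans (Modules A T) C (F \<circ>\<circ> forget) (G \<circ>\<circ> forget) t"
    and iso_free: "\<And>a. a \<in> Obj A \<Longrightarrow> iso C (t (OMap T a, Mult T a))"
    and x: "x \<in> Obj (Modules A T)"
  shows "iso C (t x)"
proof -
  interpret F: cat_functor A C F by fact
  interpret G: cat_functor A C G by fact
  interpret t: nat_trans "Modules A T" C "F \<circ>\<circ> forget" "G \<circ>\<circ> forget" t by fact
  obtain a h where x_eq: "x = (a, h)" by (cases x)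
  note x = x[unfolded x_eq]
  then have [simp]: "a \<in> Obj A" "h \<in> Arr A" "Dom A h = OMap T a" "Cod A h = a"
      and h_unit: "h \<cdot> Unit T a = Ide A a" and h_assoc: "h \<cdot> AMap T h = h \<cdot> Mult T a"
    by (simp_all add: hom_iff)
  let ?\<phi> = "\<lambda>a. (OMap T a, Mult T a)"
  have free [simp]: "?\<phi> a \<in> Obj (Modules A T)" if "a \<in> Obj A" for a
    using free_object[OF that] .
  have "\<exists>s. \<forall>a\<in>Obj A. s a \<in> hom C (OMap G (OMap T a)) (OMap F (OMap T a)) \<and>
      s a \<cdot>\<^bsub>C\<^esub> t (?\<phi> a) = Ide C (OMap F (OMap T a)) \<and> t (?\<phi> a) \<cdot>\<^bsub>C\<^esub> s a = Ide C (OMap G (OMap T a))"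
  proof (rule bchoice, rule ballI)
    fix a assume a: "a \<in> Obj A"
    show "\<exists>s. s \<in> hom C (OMap G (OMap T a)) (OMap F (OMap T a)) \<and>
        s \<cdot>\<^bsub>C\<^esub> t (?\<phi> a) = Ide C (OMap F (OMap T a)) \<and> t (?\<phi> a) \<cdot>\<^bsub>C\<^esub> s = Ide C (OMap G (OMap T a))"
      using F.B.iso_obtain_inverse[OF iso_free[OF a] t.component[OF free[OF a]]] by auto
  qed
  then obtain s where s: "\<And>a. a \<in> Obj A \<Longrightarrow> s a \<in> hom C (OMap G (OMap T a)) (OMap F (OMap T a))"
      and st: "\<And>a. a \<in> Obj A \<Longrightarrow> s a \<cdot>\<^bsub>C\<^esub> t (?\<phi> a) = Ide C (OMap F (OMap T a))"
      and ts: "\<And>a. a \<in> Obj A \<Longrightarrow> t (?\<phi> a) \<cdot>\<^bsub>C\<^esub> s a = Ide C (OMap G (OMap T a))"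
    by blast
  have [simp]: "s a \<in> Arr C" "Dom C (s a) = OMap G (OMap T a)" "Cod C (s a) = OMap F (OMap T a)"
    if "a \<in> Obj A" for a using s[OF that] by (simp_all add: hom_iff)
  have t_simps [simp]: "t (?\<phi> a) \<in> Arr C" "Dom C (t (?\<phi> a)) = OMap F (OMap T a)"
    "Cod C (t (?\<phi> a)) = OMap G (OMap T a)" if "a \<in> Obj A" for a
    using t.component[OF free[OF that]] by (simp_all add: hom_iff)
  have [simp]: "t (a, h) \<in> Arr C" "Dom C (t (a, h)) = OMap F a" "Cod C (t (a, h)) = OMap G a"
    using t.component[OF x] by (simp_all add: hom_iff)
  have t_nat: "t y' \<cdot>\<^bsub>C\<^esub> AMap F f = AMap G f \<cdot>\<^bsub>C\<^esub> t y" if "(y, f, y') \<in> Arr (Modules A T)" for y f y'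
    using t.naturality[of "(y, f, y')" y y'] that by (simp add: hom_Modules_iff)
  have s_nat: "s a \<cdot>\<^bsub>C\<^esub> AMap G f = AMap F f \<cdot>\<^bsub>C\<^esub> s b"
    if arr: "(?\<phi> b, f, ?\<phi> a) \<in> Arr (Modules A T)" and [simp]: "a \<in> Obj A" "b \<in> Obj A" for a b f
  proof -
    have [simp]: "f \<in> Arr A" "Dom A f = OMap T b" "Cod A f = OMap T a"
      using arr by (simp_all add: hom_iff)
    have "s a \<cdot>\<^bsub>C\<^esub> AMap G f = s a \<cdot>\<^bsub>C\<^esub> ((AMap G f \<cdot>\<^bsub>C\<^esub> t (?\<phi> b)) \<cdot>\<^bsub>C\<^esub> s b)"
      by (simp add: F.B.assoc ts)
    also have "\<dots> = (s a \<cdot>\<^bsub>C\<^esub> t (?\<phi> a)) \<cdot>\<^bsub>C\<^esub> (AMap F f \<cdot>\<^bsub>C\<^esub> s b)"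
      unfolding t_nat[OF arr, symmetric] by (simp add: F.B.assoc)
    also have "\<dots> = AMap F f \<cdot>\<^bsub>C\<^esub> s b" by (simp add: st)
    finally show ?thesis .
  qed
  have h_arr: "(?\<phi> a, h, (a, h)) \<in> Arr (Modules A T)"
    using x free_object[of a] h_assoc by (simp add: hom_iff)
  have Th_arr: "(?\<phi> (OMap T a), AMap T h, ?\<phi> a) \<in> Arr (Modules A T)"
    by (rule free_arrow) (simp add: hom_iff)
  have m_arr: "(?\<phi> (OMap T a), Mult T a, ?\<phi> a) \<in> Arr (Modules A T)"
    using free_object[of a] free_object[of "OMap T a"] mult_assoc[of a] by (simp add: hom_iff)
  define r where "r = AMap F h \<cdot>\<^bsub>C\<^esub> (s a \<cdot>\<^bsub>C\<^esub> AMap G (Unit T a))"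
  have r: "r \<in> hom C (OMap G a) (OMap F a)" by (simp add: r_def hom_iff)
  note [simp] = r[unfolded hom_iff]
  have "t (a, h) \<cdot>\<^bsub>C\<^esub> r = (t (a, h) \<cdot>\<^bsub>C\<^esub> AMap F h) \<cdot>\<^bsub>C\<^esub> (s a \<cdot>\<^bsub>C\<^esub> AMap G (Unit T a))"
    by (simp add: r_def F.B.assoc)
  also have "\<dots> = AMap G h \<cdot>\<^bsub>C\<^esub> ((t (?\<phi> a) \<cdot>\<^bsub>C\<^esub> s a) \<cdot>\<^bsub>C\<^esub> AMap G (Unit T a))"
    unfolding t_nat[OF h_arr] by (simp add: F.B.assoc)
  also have "\<dots> = Ide C (OMap G a)" by (simp add: ts h_unit flip: G.comp)
  finally have tr: "t (a, h) \<cdot>\<^bsub>C\<^esub> r = Ide C (OMap G a)" .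
  \<comment> \<open>\<open>F h\<close> is a split epimorphism, so the other equation may be checked after composing with it.\<close>
  have "(r \<cdot>\<^bsub>C\<^esub> t (a, h)) \<cdot>\<^bsub>C\<^esub> AMap F h = r \<cdot>\<^bsub>C\<^esub> (t (a, h) \<cdot>\<^bsub>C\<^esub> AMap F h)"
    by (simp add: F.B.assoc)
  also have "\<dots> = AMap F h \<cdot>\<^bsub>C\<^esub> (s a \<cdot>\<^bsub>C\<^esub> (AMap G (Unit T a \<cdot> h) \<cdot>\<^bsub>C\<^esub> t (?\<phi> a)))"
    unfolding t_nat[OF h_arr] by (simp add: r_def F.B.assoc G.comp)
  also have "Unit T a \<cdot> h = AMap T h \<cdot> Unit T (OMap T a)"
    using unit.natural[of h] by simp
  also have "AMap F h \<cdot>\<^bsub>C\<^esub> (s a \<cdot>\<^bsub>C\<^esub> (AMap G (AMap T h \<cdot> Unit T (OMap T a)) \<cdot>\<^bsub>C\<^esub> t (?\<phi> a))) =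
      AMap F h \<cdot>\<^bsub>C\<^esub> ((s a \<cdot>\<^bsub>C\<^esub> AMap G (AMap T h)) \<cdot>\<^bsub>C\<^esub> (AMap G (Unit T (OMap T a)) \<cdot>\<^bsub>C\<^esub> t (?\<phi> a)))"
    by (simp add: F.B.assoc G.comp)
  also have "\<dots> = AMap F (h \<cdot> AMap T h) \<cdot>\<^bsub>C\<^esub> (s (OMap T a) \<cdot>\<^bsub>C\<^esub> (AMap G (Unit T (OMap T a)) \<cdot>\<^bsub>C\<^esub> t (?\<phi> a)))"
    unfolding s_nat[OF Th_arr \<open>a \<in> Obj A\<close> endo.obj_closed[OF \<open>a \<in> Obj A\<close>]]
    by (simp add: F.B.assoc F.comp)
  also have "\<dots> = AMap F h \<cdot>\<^bsub>C\<^esub> ((AMap F (Mult T a) \<cdot>\<^bsub>C\<^esub> s (OMap T a)) \<cdot>\<^bsub>C\<^esub>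
      (AMap G (Unit T (OMap T a)) \<cdot>\<^bsub>C\<^esub> t (?\<phi> a)))"
    unfolding h_assoc by (simp add: F.B.assoc F.comp)
  also have "\<dots> = AMap F h \<cdot>\<^bsub>C\<^esub> (s a \<cdot>\<^bsub>C\<^esub> (AMap G (Mult T a \<cdot> Unit T (OMap T a)) \<cdot>\<^bsub>C\<^esub> t (?\<phi> a)))"
    unfolding s_nat[OF m_arr \<open>a \<in> Obj A\<close> endo.obj_closed[OF \<open>a \<in> Obj A\<close>], symmetric]
    by (simp add: F.B.assoc G.comp)
  also have "\<dots> = AMap F h" by (simp add: unit_left st)
  finally have "((r \<cdot>\<^bsub>C\<^esub> t (a, h)) \<cdot>\<^bsub>C\<^esub> AMap F h) \<cdot>\<^bsub>C\<^esub> AMap F (Unit T a) = AMap F h \<cdot>\<^bsub>C\<^esub> AMap F (Unit T a)"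
    by simp
  moreover have "AMap F h \<cdot>\<^bsub>C\<^esub> AMap F (Unit T a) = Ide C (OMap F a)"
    by (simp add: h_unit flip: F.comp)
  ultimately have rt: "r \<cdot>\<^bsub>C\<^esub> t (a, h) = Ide C (OMap F a)"
    by (simp add: F.B.assoc)
  show ?thesis
    unfolding x_eq by (rule F.B.isoI[OF _ r rt tr]) (simp add: hom_iff)
qed


section \<open>The comonad on modules induced by an entwining\<close>

lemma lift_comonad_simps [simp]:
  "OMap (lift_comonad A G \<Lambda>) x = (OMap G (fst x), AMap G (snd x) \<cdot>\<^bsub>A\<^esub> \<Lambda> (fst x))"
  "AMap (lift_comonad A G \<Lambda>) (x, f, y) =
     (OMap (lift_comonad A G \<Lambda>) x, AMap G f, OMap (lift_comonad A G \<Lambda>) y)"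
  "Comult (lift_comonad A G \<Lambda>) x = (OMap (lift_comonad A G \<Lambda>) x, Comult G (fst x),
     OMap (lift_comonad A G \<Lambda>) (OMap (lift_comonad A G \<Lambda>) x))"
  "Counit (lift_comonad A G \<Lambda>) x = (OMap (lift_comonad A G \<Lambda>) x, Counit G (fst x), x)"
  by (simp_all add: lift_comonad_def Let_def split_beta)

text \<open>Each axiom of an entwining provides exactly one thing: unit and multiplication make the lifted object
a module, comultiplication and counit make the structure maps of \<open>G\<close> module maps. The comonad
equations are then inherited from \<open>G\<close>, as module maps are compared by their underlying arrows.\<close>

context entwining
begin

abbreviation "GT \<equiv> lift_comonad A G \<Lambda>"

lemma lift_object:
  assumes "(a, h) \<in> Obj (Modules A T)"
  shows "(OMap G a, AMap G h \<cdot> \<Lambda> a) \<in> Obj (Modules A T)"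
proof -
  have [simp]: "a \<in> Obj A" "h \<in> Arr A" "Dom A h = OMap T a" "Cod A h = a"
      and h_unit: "h \<cdot> Unit T a = Ide A a" and h_assoc: "h \<cdot> AMap T h = h \<cdot> Mult T a"
    using assms by (simp_all add: hom_iff)
  have unit: "(AMap G h \<cdot> \<Lambda> a) \<cdot> Unit T (OMap G a) = Ide A (OMap G a)"
    by (simp add: T.endo.A.assoc entw_unit h_unit flip: G.endo.comp)
  have "(AMap G h \<cdot> \<Lambda> a) \<cdot> AMap T (AMap G h \<cdot> \<Lambda> a) =
      AMap G h \<cdot> ((\<Lambda> a \<cdot> AMap T (AMap G h)) \<cdot> AMap T (\<Lambda> a))"
    by (simp add: T.endo.A.assoc T.endo.comp)
  also have "\<dots> = AMap G (h \<cdot> AMap T h) \<cdot> (\<Lambda> (OMap T a) \<cdot> AMap T (\<Lambda> a))"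
    using natural[of h] by (simp add: T.endo.A.assoc G.endo.comp)
  also have "\<dots> = AMap G h \<cdot> (AMap G (Mult T a) \<cdot> \<Lambda> (OMap T a) \<cdot> AMap T (\<Lambda> a))"
    unfolding h_assoc by (simp add: T.endo.A.assoc G.endo.comp)
  also have "\<dots> = (AMap G h \<cdot> \<Lambda> a) \<cdot> Mult T (OMap G a)"
    unfolding entw_mult[OF \<open>a \<in> Obj A\<close>, symmetric] by (simp add: T.endo.A.assoc)
  finally show ?thesis
    using unit by (simp add: hom_iff)
qed

lemma lift_arrow:
  assumes "((a, h), f, (b, k)) \<in> Arr (Modules A T)"
  shows "((OMap G a, AMap G h \<cdot> \<Lambda> a), AMap G f, (OMap G b, AMap G k \<cdot> \<Lambda> b)) \<in> Arr (Modules A T)"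
proof -
  have objs: "(a, h) \<in> Obj (Modules A T)" "(b, k) \<in> Obj (Modules A T)" using assms by simp_all
  have [simp]: "a \<in> Obj A" "h \<in> Arr A" "Dom A h = OMap T a" "Cod A h = a"
    "b \<in> Obj A" "k \<in> Arr A" "Dom A k = OMap T b" "Cod A k = b"
    "f \<in> Arr A" "Dom A f = a" "Cod A f = b" and eq: "f \<cdot> h = k \<cdot> AMap T f"
    using assms by (simp_all add: hom_iff)
  have "AMap G f \<cdot> (AMap G h \<cdot> \<Lambda> a) = AMap G (f \<cdot> h) \<cdot> \<Lambda> a"
    by (simp add: T.endo.A.assoc G.endo.comp)
  also have "\<dots> = AMap G k \<cdot> (AMap G (AMap T f) \<cdot> \<Lambda> a)"
    unfolding eq by (simp add: T.endo.A.assoc G.endo.comp)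
  also have "\<dots> = (AMap G k \<cdot> \<Lambda> b) \<cdot> AMap T (AMap G f)"
    using natural[of f] by (simp add: T.endo.A.assoc)
  finally show ?thesis
    using lift_object[OF objs(1)] lift_object[OF objs(2)] by (simp add: hom_iff)
qed

lemma lift_comult:
  assumes "(a, h) \<in> Obj (Modules A T)"
  shows "Comult GT (a, h) \<in> Arr (Modules A T)"
proof -
  have [simp]: "a \<in> Obj A" "h \<in> Arr A" "Dom A h = OMap T a" "Cod A h = a"
    using assms by (simp_all add: hom_iff)
  have "Comult G a \<cdot> (AMap G h \<cdot> \<Lambda> a) = (Comult G a \<cdot> AMap G h) \<cdot> \<Lambda> a"
    by (simp add: T.endo.A.assoc)
  also have "\<dots> = AMap G (AMap G h) \<cdot> (Comult G (OMap T a) \<cdot> \<Lambda> a)"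
    using G.comult.natural[of h] by (simp add: T.endo.A.assoc)
  also have "\<dots> = (AMap G (AMap G h \<cdot> \<Lambda> a) \<cdot> \<Lambda> (OMap G a)) \<cdot> AMap T (Comult G a)"
    by (simp add: entw_comult T.endo.A.assoc G.endo.comp)
  finally show ?thesis
    using lift_object[OF assms] lift_object[OF lift_object[OF assms]] by (simp add: hom_iff)
qed

lemma lift_counit:
  assumes "(a, h) \<in> Obj (Modules A T)"
  shows "Counit GT (a, h) \<in> Arr (Modules A T)"
proof -
  have [simp]: "a \<in> Obj A" "h \<in> Arr A" "Dom A h = OMap T a" "Cod A h = a"
    using assms by (simp_all add: hom_iff)
  have "Counit G a \<cdot> (AMap G h \<cdot> \<Lambda> a) = (Counit G a \<cdot> AMap G h) \<cdot> \<Lambda> a"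
    by (simp add: T.endo.A.assoc)
  also have "\<dots> = h \<cdot> (Counit G (OMap T a) \<cdot> \<Lambda> a)"
    using G.counit.natural[of h] by (simp add: T.endo.A.assoc)
  also have "\<dots> = h \<cdot> AMap T (Counit G a)" by (simp add: entw_counit)
  finally show ?thesis
    using lift_object[OF assms] assms by (simp add: hom_iff)
qed

lemma functor_lift: "cat_functor (Modules A T) (Modules A T) GT"
proof -
  interpret M: category "Modules A T" by (rule category_Modules) (rule T.endo.cat_functor_axioms)
  show ?thesis
  proof
    fix x assume x: "x \<in> Obj (Modules A T)"
    obtain a h where [simp]: "x = (a, h)" by (cases x)
    have [simp]: "a \<in> Obj A" using x by simp
    show "OMap GT x \<in> Obj (Modules A T)" using lift_object x by simp
    show "AMap GT (Ide (Modules A T) x) = Ide (Modules A T) (OMap GT x)" by simp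
  next
    fix u x y assume "u \<in> hom (Modules A T) x y"
    then obtain f where [simp]: "u = (x, f, y)" and u: "(x, f, y) \<in> Arr (Modules A T)"
      unfolding hom_Modules_iff by blast
    obtain a h b k where [simp]: "x = (a, h)" "y = (b, k)" by (cases x, cases y)
    show "AMap GT u \<in> hom (Modules A T) (OMap GT x) (OMap GT y)"
      using lift_arrow[of a h f b k] u by (simp add: hom_Modules_iff del: Modules_simps(2))
  next
    fix u x y v z assume "u \<in> hom (Modules A T) x y" "v \<in> hom (Modules A T) y z"
    then obtain f g where "u = (x, f, y)" "(x, f, y) \<in> Arr (Modules A T)"
        "v = (y, g, z)" "(y, g, z) \<in> Arr (Modules A T)"
      unfolding hom_Modules_iff by blast
    then show "AMap GT (v \<cdot>\<^bsub>Modules A T\<^esub> u) = AMap GT v \<cdot>\<^bsub>Modules A T\<^esub> AMap GT u"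
      by (simp add: hom_iff G.endo.comp)
  qed
qed

lemma comonad_lift: "comonad (Modules A T) GT"
proof -
  interpret GT: cat_functor "Modules A T" "Modules A T" GT by (rule functor_lift)
  interpret GTGT: cat_functor "Modules A T" "Modules A T" "GT \<circ>\<circ> GT"
    by (rule cat_functor_comp) (rule functor_lift)+
  interpret I: cat_functor "Modules A T" "Modules A T" id_ftr
    by (rule cat_functor_id) (rule GT.A.category_axioms)
  show ?thesis
  proof
    fix x assume x: "x \<in> Obj (Modules A T)"
    obtain a h where [simp]: "x = (a, h)" by (cases x)
    have [simp]: "a \<in> Obj A" using x by simp
    show "Comult GT x \<in> hom (Modules A T) (OMap GT x) (OMap (GT \<circ>\<circ> GT) x)"
      using lift_comult[of a h] x by (simp add: hom_Modules_iff del: Modules_simps(2))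
    show "Counit GT x \<in> hom (Modules A T) (OMap GT x) (OMap id_ftr x)"
      using lift_counit[of a h] x by (simp add: hom_Modules_iff del: Modules_simps(2))
    show "AMap GT (Comult GT x) \<cdot>\<^bsub>Modules A T\<^esub> Comult GT x =
        Comult GT (OMap GT x) \<cdot>\<^bsub>Modules A T\<^esub> Comult GT x"
      by (simp add: G.comult_coassoc)
    show "Counit GT (OMap GT x) \<cdot>\<^bsub>Modules A T\<^esub> Comult GT x = Ide (Modules A T) (OMap GT x)"
      by (simp add: G.counit_left)
    show "AMap GT (Counit GT x) \<cdot>\<^bsub>Modules A T\<^esub> Comult GT x = Ide (Modules A T) (OMap GT x)"
      by (simp add: G.counit_right)
  next
    fix u x y assume "u \<in> hom (Modules A T) x y"
    then obtain f where [simp]: "u = (x, f, y)" and "(x, f, y) \<in> Arr (Modules A T)"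
      unfolding hom_Modules_iff by blast
    then have f: "f \<in> hom A (fst x) (fst y)" by simp
    show "Comult GT y \<cdot>\<^bsub>Modules A T\<^esub> AMap GT u = AMap (GT \<circ>\<circ> GT) u \<cdot>\<^bsub>Modules A T\<^esub> Comult GT x"
      using G.comult.naturality[OF f] by simp
    show "Counit GT y \<cdot>\<^bsub>Modules A T\<^esub> AMap GT u = AMap id_ftr u \<cdot>\<^bsub>Modules A T\<^esub> Counit GT x"
      using G.counit.naturality[OF f] by simp
  qed
qed

end

section \<open>The Galois condition\<close>

text \<open>The component of \<open>canonical\<close> at \<open>(a, h)\<close> has the underlying arrow \<open>G h \<cdot> \<beta>\<^sub>a\<close>, which is the Galois map
for a free module. An arrow of modules is invertible as soon as its underlying arrow is, so the
condition on \<open>canonical\<close> is a condition in \<open>A\<close>, and free modules suffice to test it.\<close>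

theorem (in entwining) equivalence_iff_galois:
  assumes K: "cat_functor A (Comodules (Modules A T) (lift_comonad A G \<Lambda>)) K"
    and over: "eq_ftr A (forget \<circ>\<circ> K) (free A T)"
  shows "equivalence A (Comodules (Modules A T) (lift_comonad A G \<Lambda>)) K \<longleftrightarrow>
    comodule_galois A T G (\<lambda>a. AMap forget (structure_of K a)) \<and> effective_descent_type A T"
proof -
  let ?M = "Modules A T"
  interpret adjunction A ?M "free A T" forget "Unit T" "free_counit A T"
    by (rule T.adjunction_free)
  interpret GT: comonad ?M GT by (rule comonad_lift)
  interpret K: cat_functor A "Comodules ?M GT" K by (rule K)
  interpret adjoint_comodule_functor A ?M "free A T" forget "Unit T" "free_counit A T" GT K
    by unfold_locales (rule over)
  define b where "b a = AMap forget (structure_of K a)" for a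
  have \<beta>: "\<beta> a = (OMap (free A T) a, b a, OMap GT (OMap (free A T) a))"
      and b: "b a \<in> hom A (OMap T a) (OMap G (OMap T a))" if "a \<in> Obj A" for a
  proof -
    have "\<beta> a \<in> hom ?M (OMap (free A T) a) (OMap GT (OMap (free A T) a))"
      using coaction[OF that] unfolding hom_iff by blast
    then show "\<beta> a = (OMap (free A T) a, b a, OMap GT (OMap (free A T) a))"
        and "b a \<in> hom A (OMap T a) (OMap G (OMap T a))"
      by (auto simp: hom_Modules_iff b_def)
  qed
  have canonical: "canonical x = (OMap (free A T) (fst x), AMap G (snd x) \<cdot> b (fst x), OMap GT x)"
    if "x \<in> Obj ?M" for x
    using that by (cases x) (simp add: canonical_def \<beta>)
  define t where "t x = AMap forget (canonical x)" for x
  have iso_t: "iso ?M (canonical x) \<longleftrightarrow> iso A (t x)" if x: "x \<in> Obj ?M" for x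
  proof -
    have arr: "canonical x \<in> Arr ?M" using x by (rule canonical_simps(1))
    show ?thesis
      using iso_Modules_iff[OF T.endo.cat_functor_axioms arr[unfolded canonical[OF x]]]
      by (simp add: t_def canonical[OF x])
  qed
  have t_nat: "nat_trans ?M A (T \<circ>\<circ> forget) (G \<circ>\<circ> forget) t"
  proof (intro nat_trans.intro nat_trans_axioms.intro cat_functor_comp[where B = A])
    fix x assume x: "x \<in> Obj ?M"
    have "canonical x \<in> hom ?M (OMap (free A T) (fst x)) (OMap GT x)"
      using canonical_simps[OF x] by (simp add: hom_iff)
    then show "t x \<in> hom A (OMap (T \<circ>\<circ> forget) x) (OMap (G \<circ>\<circ> forget) x)"
      by (auto simp: hom_Modules_iff t_def)
  next
    fix u x y assume u: "u \<in> hom ?M x y"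
    then have xy: "x \<in> Obj ?M" "y \<in> Obj ?M"
      by (auto simp: hom_Modules_iff simp del: Modules_simps(1))
    obtain f where [simp]: "u = (x, f, y)" and "(x, f, y) \<in> Arr ?M"
      using u unfolding hom_Modules_iff by blast
    then have "Dom A f = fst x" "Cod A f = fst y" by (simp_all add: hom_iff)
    then show "t y \<cdot> AMap (T \<circ>\<circ> forget) u = AMap (G \<circ>\<circ> forget) u \<cdot> t x"
      using canonical_natural[OF u] by (simp add: canonical xy t_def)
  qed (rule right.cat_functor_axioms T.endo.cat_functor_axioms G.endo.cat_functor_axioms)+
  interpret t: nat_trans ?M A "T \<circ>\<circ> forget" "G \<circ>\<circ> forget" t by (rule t_nat)
  have t_free: "t (OMap T a, Mult T a) = AMap G (Mult T a) \<cdot> b (OMap T a)" if "a \<in> Obj A" for a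
    using canonical[OF T.free_object[OF that]] by (simp add: t_def)
  have "comodule_galois A T G b \<longleftrightarrow> (\<forall>a\<in>Obj A. iso A (t (OMap T a, Mult T a)))"
    unfolding comodule_galois_def
  proof
    assume "nat_iso A A (T \<circ>\<circ> T) (G \<circ>\<circ> T) (\<lambda>a. AMap G (Mult T a) \<cdot> b (OMap T a))"
    then interpret nat_iso A A "T \<circ>\<circ> T" "G \<circ>\<circ> T" "\<lambda>a. AMap G (Mult T a) \<cdot> b (OMap T a)" .
    show "\<forall>a\<in>Obj A. iso A (t (OMap T a, Mult T a))" using component_iso t_free by simp
  next
    assume *: "\<forall>a\<in>Obj A. iso A (t (OMap T a, Mult T a))"
    show "nat_iso A A (T \<circ>\<circ> T) (G \<circ>\<circ> T) (\<lambda>a. AMap G (Mult T a) \<cdot> b (OMap T a))"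
    proof (intro nat_iso.intro nat_trans.intro nat_trans_axioms.intro nat_iso_axioms.intro
        cat_functor_comp[where B = A])
      fix a assume a: "a \<in> Obj A"
      show "AMap G (Mult T a) \<cdot> b (OMap T a) \<in> hom A (OMap (T \<circ>\<circ> T) a) (OMap (G \<circ>\<circ> T) a)"
        using t.component[OF T.free_object[OF a]] t_free[OF a] by simp
      show "iso A (AMap G (Mult T a) \<cdot> b (OMap T a))" using bspec[OF * a] unfolding t_free[OF a] .
    next
      fix f a c assume f: "f \<in> hom A a c"
      then have [simp]: "a \<in> Obj A" "c \<in> Obj A" by (auto simp: hom_iff)
      show "(AMap G (Mult T c) \<cdot> b (OMap T c)) \<cdot> AMap (T \<circ>\<circ> T) f =
          AMap (G \<circ>\<circ> T) f \<cdot> (AMap G (Mult T a) \<cdot> b (OMap T a))"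
        using t.naturality[of "((OMap T a, Mult T a), AMap T f, (OMap T c, Mult T c))"]
          T.free_arrow[OF f]
        by (simp add: hom_Modules_iff t_free del: Modules_simps(2))
    qed (rule T.endo.cat_functor_axioms G.endo.cat_functor_axioms)+
  qed
  also have "\<dots> \<longleftrightarrow> (\<forall>x\<in>Obj ?M. iso A (t x))"
    using T.iso_on_modules_if_iso_on_free_modules[OF T.endo.cat_functor_axioms G.endo.cat_functor_axioms t_nat]
      T.free_object by blast
  also have "\<dots> \<longleftrightarrow> (\<forall>x\<in>Obj ?M. iso ?M (canonical x))"
    using iso_t by blast
  finally show ?thesis
    unfolding equivalence_iff_canonical_iso effective_descent_type_def comonadic_def b_def
    using adjunction_axioms by blast
qed

section \<open>Duality\<close>

definition opposite :: "('o, 'm) category \<Rightarrow> ('o, 'm) category" where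
  "opposite A = \<lparr>Obj = Obj A, Arr = Arr A, Dom = Cod A, Cod = Dom A, Ide = Ide A,
     Comp = (\<lambda>g f. Comp A f g)\<rparr>"

lemma opposite_simps [simp]:
  "Obj (opposite A) = Obj A" "Arr (opposite A) = Arr A" "Dom (opposite A) = Cod A"
  "Cod (opposite A) = Dom A" "Ide (opposite A) = Ide A" "g \<cdot>\<^bsub>opposite A\<^esub> f = f \<cdot>\<^bsub>A\<^esub> g"
  "opposite (opposite A) = A"
  by (simp_all add: opposite_def)

lemma hom_opposite [simp]: "hom (opposite A) a b = hom A b a"
  by (auto simp: hom_def)

lemma iso_opposite [simp]: "iso (opposite A) f \<longleftrightarrow> iso A f"
  unfolding iso_def by auto

lemma category_opposite: "category A \<Longrightarrow> category (opposite A)"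
proof -
  assume "category A"
  then interpret category A .
  show ?thesis
    by unfold_locales (auto simp: hom_iff assoc)
qed

lemma nat_iso_opposite:
  assumes "nat_iso A B F H \<tau>"
  shows "nat_iso (opposite A) (opposite B) H F \<tau>"
proof -
  interpret nat_iso A B F H \<tau> by fact
  show ?thesis
    by (intro nat_iso.intro nat_trans.intro nat_trans_axioms.intro nat_iso_axioms.intro
        cat_functor.intro cat_functor_axioms.intro category_opposite)
      (auto simp: F.A.category_axioms F.B.category_axioms F.comp H.comp component component_iso naturality hom_iff)
qed

lemma nat_iso_opposite_iff: "nat_iso (opposite A) (opposite B) H F \<tau> \<longleftrightarrow> nat_iso A B F H \<tau>"
  using nat_iso_opposite[of A B F H \<tau>] nat_iso_opposite[of "opposite A" "opposite B" H F \<tau>] by auto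

definition op_monad :: "('o, 'm) monad \<Rightarrow> ('o, 'm) comonad" where
  "op_monad T = \<lparr>OMap = OMap T, AMap = AMap T, Comult = Mult T, Counit = Unit T\<rparr>"

definition op_comonad :: "('o, 'm) comonad \<Rightarrow> ('o, 'm) monad" where
  "op_comonad G = \<lparr>OMap = OMap G, AMap = AMap G, Mult = Comult G, Unit = Counit G\<rparr>"

lemma op_monad_simps [simp]:
  "OMap (op_monad T) = OMap T" "AMap (op_monad T) = AMap T"
  "Comult (op_monad T) = Mult T" "Counit (op_monad T) = Unit T"
  by (simp_all add: op_monad_def)

lemma op_comonad_simps [simp]:
  "OMap (op_comonad G) = OMap G" "AMap (op_comonad G) = AMap G"
  "Mult (op_comonad G) = Comult G" "Unit (op_comonad G) = Counit G"
  by (simp_all add: op_comonad_def)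

lemma (in monad) comonad_opposite: "comonad (opposite A) (op_monad T)"
proof -
  interpret op: category "opposite A" by (rule category_opposite) (rule endo.A.category_axioms)
  show ?thesis
    by unfold_locales
      (auto simp: endo.comp hom_iff mult.natural unit.natural mult_assoc unit_left unit_right
        dest: mult.natural[simplified] unit.natural[simplified])
qed

lemma (in comonad) monad_opposite: "monad (opposite A) (op_comonad G)"
proof -
  interpret op: category "opposite A" by (rule category_opposite) (rule endo.A.category_axioms)
  show ?thesis
    by unfold_locales
      (auto simp: endo.comp hom_iff comult.natural counit.natural comult_coassoc counit_left counit_right
        dest: comult.natural[simplified] counit.natural[simplified])
qed

lemma (in entwining) entwining_opposite: "entwining (opposite A) (op_comonad G) (op_monad T) \<Lambda>"
proof -
  interpret T': comonad "opposite A" "op_monad T" by (rule T.comonad_opposite)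
  interpret G': monad "opposite A" "op_comonad G" by (rule G.monad_opposite)
  show ?thesis
    by unfold_locales
      (auto simp: T.endo.comp G.endo.comp hom_iff entw_unit entw_counit entw_comult entw_mult
         T.endo.A.assoc dest: natural[simplified])
qed

text \<open>A contravariant isomorphism of categories, given by its maps \<open>\<Omega>\<close> on objects and \<open>\<rho>\<close> on arrows. The
maps are bijections of the ambient types and all equations are required without reference to the
carriers. This spares side conditions, and it holds in the case of interest because there the maps
only rearrange tuples.\<close>

locale anti_isomorphism =
  fixes C :: "('o, 'm) category" and C' :: "('p, 'n) category" and \<Omega> :: "'o \<Rightarrow> 'p" and \<rho> :: "'m \<Rightarrow> 'n"
  assumes bij_\<Omega>: "bij \<Omega>" and bij_\<rho>: "bij \<rho>"
    and Obj [simp]: "\<Omega> x \<in> Obj C' \<longleftrightarrow> x \<in> Obj C"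
    and Arr [simp]: "\<rho> f \<in> Arr C' \<longleftrightarrow> f \<in> Arr C"
    and Dom [simp]: "Dom C' (\<rho> f) = \<Omega> (Cod C f)"
    and Cod [simp]: "Cod C' (\<rho> f) = \<Omega> (Dom C f)"
    and Ide [simp]: "Ide C' (\<Omega> x) = \<rho> (Ide C x)"
    and Comp [simp]: "\<rho> g \<cdot>\<^bsub>C'\<^esub> \<rho> f = \<rho> (f \<cdot>\<^bsub>C\<^esub> g)"
begin

lemma \<Omega>_eq_iff [simp]: "\<Omega> x = \<Omega> y \<longleftrightarrow> x = y"
  using bij_\<Omega> by (simp add: bij_def inj_eq)

lemma \<rho>_eq_iff [simp]: "\<rho> f = \<rho> g \<longleftrightarrow> f = g"
  using bij_\<rho> by (simp add: bij_def inj_eq)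

lemma \<Omega>_surj: obtains y where "x = \<Omega> y"
  using bij_\<Omega> by (auto simp: bij_def surj_def)

lemma \<rho>_surj: obtains g where "f = \<rho> g"
  using bij_\<rho> by (auto simp: bij_def surj_def)

lemma hom_iff' [simp]: "\<rho> f \<in> hom C' (\<Omega> x) (\<Omega> y) \<longleftrightarrow> f \<in> hom C y x"
  by (auto simp: hom_iff)

lemma hom_image: "hom C' (\<Omega> x) (\<Omega> y) = \<rho> ` hom C y x"
proof (intro set_eqI iffI)
  fix f assume f: "f \<in> hom C' (\<Omega> x) (\<Omega> y)"
  obtain g where "f = \<rho> g" by (rule \<rho>_surj)
  with f show "f \<in> \<rho> ` hom C y x" by simp
qed auto

lemma iso_iff [simp]: "iso C' (\<rho> f) \<longleftrightarrow> iso C f"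
proof -
  have "iso C' (\<rho> f) \<longleftrightarrow> (\<exists>x y g. \<rho> f \<in> hom C' (\<Omega> x) (\<Omega> y) \<and> \<rho> g \<in> hom C' (\<Omega> y) (\<Omega> x) \<and>
      \<rho> g \<cdot>\<^bsub>C'\<^esub> \<rho> f = Ide C' (\<Omega> x) \<and> \<rho> f \<cdot>\<^bsub>C'\<^esub> \<rho> g = Ide C' (\<Omega> y))"
    unfolding iso_def by (metis \<Omega>_surj \<rho>_surj)
  then show ?thesis unfolding iso_def by auto
qed

lemma symmetric: "anti_isomorphism C' C (inv \<Omega>) (inv \<rho>)"
proof
  show "bij (inv \<Omega>)" "bij (inv \<rho>)" using bij_\<Omega> bij_\<rho> by (simp_all add: bij_imp_bij_inv)
  have [simp]: "inv \<Omega> (\<Omega> x) = x" "inv \<rho> (\<rho> f) = f" for x f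
    using bij_\<Omega> bij_\<rho> by (simp_all add: bij_def)
  fix x' f' g'
  obtain x f g where [simp]: "x' = \<Omega> x" "f' = \<rho> f" "g' = \<rho> g" by (metis \<Omega>_surj \<rho>_surj)
  show "inv \<Omega> x' \<in> Obj C \<longleftrightarrow> x' \<in> Obj C'" "inv \<rho> f' \<in> Arr C \<longleftrightarrow> f' \<in> Arr C'"
    "Dom C (inv \<rho> f') = inv \<Omega> (Cod C' f')" "Cod C (inv \<rho> f') = inv \<Omega> (Dom C' f')"
    "Ide C (inv \<Omega> x') = inv \<rho> (Ide C' x')"
    "inv \<rho> g' \<cdot>\<^bsub>C\<^esub> inv \<rho> f' = inv \<rho> (f' \<cdot>\<^bsub>C'\<^esub> g')"
    by simp_all
qed

lemma category_dual:
  assumes "category C"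
  shows "category C'"
proof -
  interpret category C by fact
  show ?thesis
  proof
    fix f' assume "f' \<in> Arr C'"
    moreover obtain f where "f' = \<rho> f" by (rule \<rho>_surj)
    ultimately show "Dom C' f' \<in> Obj C'" "Cod C' f' \<in> Obj C'" by simp_all
  next
    fix x' assume "x' \<in> Obj C'"
    moreover obtain x where "x' = \<Omega> x" by (rule \<Omega>_surj)
    ultimately show "Ide C' x' \<in> hom C' x' x'" by (simp add: id_in_hom)
  next
    fix f' x' y' g' z' assume *: "f' \<in> hom C' x' y'" "g' \<in> hom C' y' z'"
    obtain x y z f g where "x' = \<Omega> x" "y' = \<Omega> y" "z' = \<Omega> z" "f' = \<rho> f" "g' = \<rho> g"
      by (metis \<Omega>_surj \<rho>_surj)
    with * show "g' \<cdot>\<^bsub>C'\<^esub> f' \<in> hom C' x' z'" by (simp add: comp_in_hom)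
  next
    fix f' x' y' assume *: "f' \<in> hom C' x' y'"
    obtain x y f where "x' = \<Omega> x" "y' = \<Omega> y" "f' = \<rho> f" by (metis \<Omega>_surj \<rho>_surj)
    with * show "f' \<cdot>\<^bsub>C'\<^esub> Ide C' x' = f'" "Ide C' y' \<cdot>\<^bsub>C'\<^esub> f' = f'"
      by (simp_all add: comp_id_left comp_id_right)
  next
    fix f' x' y' g' z' h' w' assume *: "f' \<in> hom C' x' y'" "g' \<in> hom C' y' z'" "h' \<in> hom C' z' w'"
    obtain x y z w where "x' = \<Omega> x" "y' = \<Omega> y" "z' = \<Omega> z" "w' = \<Omega> w"
      by (metis \<Omega>_surj)
    moreover obtain f g h where "f' = \<rho> f" "g' = \<rho> g" "h' = \<rho> h"
      by (metis \<rho>_surj)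
    ultimately show "(h' \<cdot>\<^bsub>C'\<^esub> g') \<cdot>\<^bsub>C'\<^esub> f' = h' \<cdot>\<^bsub>C'\<^esub> (g' \<cdot>\<^bsub>C'\<^esub> f')"
      using * comp_assoc[of h w z g y f x] by simp
  qed
qed

definition dual :: "('a, 'b, 'o, 'm) ftr \<Rightarrow> ('a, 'b, 'p, 'n) ftr" where
  "dual K = \<lparr>OMap = (\<lambda>a. \<Omega> (OMap K a)), AMap = (\<lambda>f. \<rho> (AMap K f))\<rparr>"

lemma dual_simps [simp]:
  "OMap (dual K) a = \<Omega> (OMap K a)" "AMap (dual K) f = \<rho> (AMap K f)"
  by (simp_all add: dual_def)

lemma functor_dual:
  assumes "cat_functor A C K"
  shows "cat_functor (opposite A) C' (dual K)"
proof -
  interpret K: cat_functor A C K by fact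
  show ?thesis
    by (intro cat_functor.intro cat_functor_axioms.intro category_opposite category_dual)
      (simp_all add: K.A.category_axioms K.B.category_axioms K.map_in_hom K.map_comp)
qed

text \<open>Essential surjectivity is the only condition that notices the change of direction, and it survives
because isomorphisms can be inverted.\<close>

lemma equivalence_dual:
  assumes eqv: "equivalence A C K"
  shows "equivalence (opposite A) C' (dual K)"
proof (rule equivalenceI)
  interpret K: cat_functor A C K using eqv unfolding equivalence_def by blast
  show "cat_functor (opposite A) C' (dual K)" by (rule functor_dual) (rule K.cat_functor_axioms)
  show "fully_faithful (opposite A) C' (dual K)"
    unfolding fully_faithful_def
  proof (intro ballI)
    fix a b assume "a \<in> Obj (opposite A)" "b \<in> Obj (opposite A)"
    then have "bij_betw (AMap K) (hom A b a) (hom C (OMap K b) (OMap K a))"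
      using equivalence_imp_fully_faithful[OF eqv] unfolding fully_faithful_def by simp
    moreover have "bij_betw \<rho> (hom C (OMap K b) (OMap K a)) (hom C' (\<Omega> (OMap K a)) (\<Omega> (OMap K b)))"
      by (auto simp: bij_betw_def inj_on_def hom_image)
    ultimately have "bij_betw (\<rho> \<circ> AMap K) (hom A b a) (hom C' (\<Omega> (OMap K a)) (\<Omega> (OMap K b)))"
      by (rule bij_betw_trans)
    then show "bij_betw (AMap (dual K)) (hom (opposite A) a b) (hom C' (OMap (dual K) a) (OMap (dual K) b))"
      by (simp add: dual_def comp_def)
  qed
  show "essentially_surjective (opposite A) C' (dual K)"
    unfolding essentially_surjective_def
  proof
    fix x' assume "x' \<in> Obj C'"
    moreover obtain x where x': "x' = \<Omega> x" by (rule \<Omega>_surj)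
    ultimately obtain a k where a: "a \<in> Obj A" and k: "k \<in> hom C (OMap K a) x" "iso C k"
      using equivalence_imp_essentially_surjective[OF eqv] unfolding essentially_surjective_def by auto
    then obtain k' where k': "k' \<in> hom C x (OMap K a)"
        "k' \<cdot>\<^bsub>C\<^esub> k = Ide C (OMap K a)" "k \<cdot>\<^bsub>C\<^esub> k' = Ide C x"
      using K.B.iso_obtain_inverse by blast
    have "iso C k'" using K.B.isoI[OF k'(1) k(1) k'(3,2)] .
    with a k'(1) show "\<exists>a\<in>Obj (opposite A). \<exists>k\<in>hom C' (OMap (dual K) a) x'. iso C' k"
      by (auto simp: x' hom_image)
  qed
qed

lemma equivalence_dual_iff: "equivalence (opposite A) C' (dual K) \<longleftrightarrow> equivalence A C K"
proof
  assume *: "equivalence (opposite A) C' (dual K)"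
  interpret sym: anti_isomorphism C' C "inv \<Omega>" "inv \<rho>" by (rule symmetric)
  have "sym.dual (dual K) = K"
    using bij_\<Omega> bij_\<rho> by (simp add: dual_def sym.dual_def bij_def)
  then show "equivalence A C K"
    using sym.equivalence_dual[OF *] by simp
qed (rule equivalence_dual)

end

text \<open>If \<open>M'\<close> is dual to \<open>M\<close> and the comonad \<open>H'\<close> corresponds to the monad \<open>H\<close>, then \<open>H'\<close>-comodules are dual
to \<open>H\<close>-modules. An object of either category is an object with a structure arrow, and an arrow is a
triple with its end points, so the maps are assembled componentwise, swapping the end points.\<close>

lemma anti_isomorphism_modules:
  fixes H :: "('o, 'm) monad" and H' :: "('p, 'n) comonad"
  assumes "anti_isomorphism M M' \<Omega> \<rho>"
    and H [simp]: "\<And>x. OMap H' (\<Omega> x) = \<Omega> (OMap H x)" "\<And>f. AMap H' (\<rho> f) = \<rho> (AMap H f)"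
      "\<And>x. Comult H' (\<Omega> x) = \<rho> (Mult H x)" "\<And>x. Counit H' (\<Omega> x) = \<rho> (Unit H x)"
  shows "anti_isomorphism (Modules M H) (Comodules M' H') (map_prod \<Omega> \<rho>)
     (\<lambda>(x, f, y). (map_prod \<Omega> \<rho> y, \<rho> f, map_prod \<Omega> \<rho> x))"
proof -
  interpret anti_isomorphism M M' \<Omega> \<rho> by fact
  have Obj': "map_prod \<Omega> \<rho> x \<in> Obj (Comodules M' H') \<longleftrightarrow> x \<in> Obj (Modules M H)" for x
    by (cases x) (simp flip: H, simp)
  show ?thesis
  proof
    show "bij (map_prod \<Omega> \<rho>)" using bij_\<Omega> bij_\<rho> by (simp add: bij_def prod.inj_map map_prod_surj)
    show "bij (\<lambda>(x, f, y). (map_prod \<Omega> \<rho> y, \<rho> f, map_prod \<Omega> \<rho> x))"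
    proof (rule bijI)
      show "inj (\<lambda>(x, f, y). (map_prod \<Omega> \<rho> y, \<rho> f, map_prod \<Omega> \<rho> x))"
        by (rule injI) auto
      show "surj (\<lambda>(x, f, y). (map_prod \<Omega> \<rho> y, \<rho> f, map_prod \<Omega> \<rho> x))"
        unfolding surj_def
      proof
        fix u :: "('p, 'n) em_arr"
        obtain c p f d q where "u = ((c, p), f, (d, q))" by (metis surj_pair)
        moreover obtain c' d' where "c = \<Omega> c'" "d = \<Omega> d'" by (metis \<Omega>_surj)
        moreover obtain p' f' q' where "p = \<rho> p'" "f = \<rho> f'" "q = \<rho> q'" by (metis \<rho>_surj)
        ultimately show "\<exists>v. u = (case v of (x, f, y) \<Rightarrow> (map_prod \<Omega> \<rho> y, \<rho> f, map_prod \<Omega> \<rho> x))"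
          by (intro exI[of _ "((d', q'), f', (c', p'))"]) simp
      qed
    qed
    fix x :: "('o, 'm) em_obj" and u v :: "('o, 'm) em_arr"
    show "map_prod \<Omega> \<rho> x \<in> Obj (Comodules M' H') \<longleftrightarrow> x \<in> Obj (Modules M H)" by (rule Obj')
    obtain y f z y' g z' where [simp]: "u = (y, f, z)" "v = (y', g, z')" by (metis surj_pair)
    show "(case u of (x, f, y) \<Rightarrow> (map_prod \<Omega> \<rho> y, \<rho> f, map_prod \<Omega> \<rho> x)) \<in> Arr (Comodules M' H') \<longleftrightarrow>
        u \<in> Arr (Modules M H)"
      using Obj'[of y] Obj'[of z]
      by (cases y; cases z) (auto simp: eq_commute simp del: Comodules_simps(1) Modules_simps(1))
    show "Dom (Comodules M' H') (case u of (x, f, y) \<Rightarrow> (map_prod \<Omega> \<rho> y, \<rho> f, map_prod \<Omega> \<rho> x)) =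
        map_prod \<Omega> \<rho> (Cod (Modules M H) u)"
      "Cod (Comodules M' H') (case u of (x, f, y) \<Rightarrow> (map_prod \<Omega> \<rho> y, \<rho> f, map_prod \<Omega> \<rho> x)) =
        map_prod \<Omega> \<rho> (Dom (Modules M H) u)"
      by simp_all
    show "Ide (Comodules M' H') (map_prod \<Omega> \<rho> x) =
        (case Ide (Modules M H) x of (x, f, y) \<Rightarrow> (map_prod \<Omega> \<rho> y, \<rho> f, map_prod \<Omega> \<rho> x))"
      by simp
    show "(case v of (x, f, y) \<Rightarrow> (map_prod \<Omega> \<rho> y, \<rho> f, map_prod \<Omega> \<rho> x)) \<cdot>\<^bsub>Comodules M' H'\<^esub>
          (case u of (x, f, y) \<Rightarrow> (map_prod \<Omega> \<rho> y, \<rho> f, map_prod \<Omega> \<rho> x)) =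
        (case u \<cdot>\<^bsub>Modules M H\<^esub> v of (x, f, y) \<Rightarrow> (map_prod \<Omega> \<rho> y, \<rho> f, map_prod \<Omega> \<rho> x))"
      by simp
  qed
qed

definition reverse :: "('o, 'm) em_arr \<Rightarrow> ('o, 'm) em_arr" where
  "reverse = (\<lambda>(x, f, y). (y, f, x))"

lemma reverse_simps [simp]: "reverse (x, f, y) = (y, f, x)" "fst (snd (reverse u)) = fst (snd u)"
  by (simp_all add: reverse_def split_beta)

text \<open>Comodules for \<open>G\<close> and modules for the opposite monad are the same pairs, whereas the triples that
encode their arrows list the end points in opposite order.\<close>

lemma anti_isomorphism_reverse:
  "anti_isomorphism (Comodules A G) (Modules (opposite A) (op_comonad G)) (\<lambda>x. x) reverse"
proof
  show "bij (\<lambda>x :: ('a, 'b) em_obj. x)" by (rule bij_id[unfolded id_def])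
  show "bij (reverse :: ('a, 'b) em_arr \<Rightarrow> _)"
    by (rule o_bij[of reverse]) (auto simp: fun_eq_iff)
  have Obj': "x \<in> Obj (Modules (opposite A) (op_comonad G)) \<longleftrightarrow> x \<in> Obj (Comodules A G)" for x
    by (cases x) auto
  fix x :: "('a, 'b) em_obj" and u v :: "('a, 'b) em_arr"
  show "x \<in> Obj (Modules (opposite A) (op_comonad G)) \<longleftrightarrow> x \<in> Obj (Comodules A G)" by (rule Obj')
  obtain y f z y' g z' where [simp]: "u = (y, f, z)" "v = (y', g, z')" by (metis surj_pair)
  show "reverse u \<in> Arr (Modules (opposite A) (op_comonad G)) \<longleftrightarrow> u \<in> Arr (Comodules A G)"
    by (auto simp: Obj')
  show "Dom (Modules (opposite A) (op_comonad G)) (reverse u) = Cod (Comodules A G) u"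
    "Cod (Modules (opposite A) (op_comonad G)) (reverse u) = Dom (Comodules A G) u"
    "Ide (Modules (opposite A) (op_comonad G)) x = reverse (Ide (Comodules A G) x)"
    "reverse v \<cdot>\<^bsub>Modules (opposite A) (op_comonad G)\<^esub> reverse u = reverse (u \<cdot>\<^bsub>Comodules A G\<^esub> v)"
    by simp_all
qed

lemma lift_monad_simps [simp]:
  "OMap (lift_monad A T \<Lambda>) x = (OMap T (fst x), \<Lambda> (fst x) \<cdot>\<^bsub>A\<^esub> AMap T (snd x))"
  "AMap (lift_monad A T \<Lambda>) (x, f, y) = (OMap (lift_monad A T \<Lambda>) x, AMap T f, OMap (lift_monad A T \<Lambda>) y)"
  "Mult (lift_monad A T \<Lambda>) x = (OMap (lift_monad A T \<Lambda>) (OMap (lift_monad A T \<Lambda>) x), Mult T (fst x),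
     OMap (lift_monad A T \<Lambda>) x)"
  "Unit (lift_monad A T \<Lambda>) x = (x, Unit T (fst x), OMap (lift_monad A T \<Lambda>) x)"
  by (simp_all add: lift_monad_def Let_def split_beta)

text \<open>The two categories in which \<open>K\<close> takes its values in the two parts of the theorem are dual to each
other, once \<open>G\<close> and \<open>T\<close> are exchanged.\<close>

lemma anti_isomorphism_lift:
  "anti_isomorphism (Modules (Comodules A G) (lift_monad A T \<Lambda>))
     (Comodules (Modules (opposite A) (op_comonad G)) (lift_comonad (opposite A) (op_monad T) \<Lambda>))
     (map_prod (\<lambda>x. x) reverse)
     (\<lambda>(x, f, y). (map_prod (\<lambda>x. x) reverse y, reverse f, map_prod (\<lambda>x. x) reverse x))"
proof (rule anti_isomorphism_modules[OF anti_isomorphism_reverse])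
  fix f :: "('a, 'b) em_arr"
  show "AMap (lift_comonad (opposite A) (op_monad T) \<Lambda>) (reverse f) = reverse (AMap (lift_monad A T \<Lambda>) f)"
    by (cases f) simp
qed simp_all

lemma adj_monad_simps [simp]:
  "OMap (adj_monad L R \<eta> \<epsilon>) a = OMap R (OMap L a)"
  "AMap (adj_monad L R \<eta> \<epsilon>) f = AMap R (AMap L f)"
  "Mult (adj_monad L R \<eta> \<epsilon>) a = AMap R (\<epsilon> (OMap L a))"
  "Unit (adj_monad L R \<eta> \<epsilon>) = \<eta>"
  by (simp_all add: adj_monad_def)

lemma monad_comparison_simps [simp]:
  "OMap (monad_comparison B R \<epsilon>) b = (OMap R b, AMap R (\<epsilon> b))"
  "AMap (monad_comparison B R \<epsilon>) f =
     ((OMap R (Dom B f), AMap R (\<epsilon> (Dom B f))), AMap R f, (OMap R (Cod B f), AMap R (\<epsilon> (Cod B f))))"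
  by (simp_all add: monad_comparison_def Let_def)

text \<open>The same duality for the targets of the comparison functors of the cofree adjunction of \<open>G\<close> and of
the free adjunction of the opposite monad.\<close>

lemma anti_isomorphism_adj_monad:
  "anti_isomorphism
     (Modules (Comodules A G) (adj_monad forget (cofree A G) (cofree_unit A G) (Counit G)))
     (Comodules (Modules (opposite A) (op_comonad G))
        (adj_comonad (free (opposite A) (op_comonad G)) forget (Unit (op_comonad G))
           (free_counit (opposite A) (op_comonad G))))
     (map_prod (\<lambda>x. x) reverse)
     (\<lambda>(x, f, y). (map_prod (\<lambda>x. x) reverse y, reverse f, map_prod (\<lambda>x. x) reverse x))"
  by (rule anti_isomorphism_modules[OF anti_isomorphism_reverse]) simp_all

lemma (in comonad) effective_codescent_type_opposite:
  "effective_descent_type (opposite A) (op_comonad G) \<longleftrightarrow> effective_codescent_type A G"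
proof -
  interpret op: monad "opposite A" "op_comonad G" by (rule monad_opposite)
  interpret anti_isomorphism
    "Modules (Comodules A G) (adj_monad forget (cofree A G) (cofree_unit A G) (Counit G))"
    "Comodules (Modules (opposite A) (op_comonad G))
        (adj_comonad (free (opposite A) (op_comonad G)) forget (Unit (op_comonad G))
           (free_counit (opposite A) (op_comonad G)))"
    "map_prod (\<lambda>x. x) reverse"
    "\<lambda>(x, f, y). (map_prod (\<lambda>x. x) reverse y, reverse f, map_prod (\<lambda>x. x) reverse x)"
    by (rule anti_isomorphism_adj_monad)
  have "dual (monad_comparison A (cofree A G) (Counit G)) =
      comonad_comparison (opposite A) (free (opposite A) (op_comonad G)) (Unit (op_comonad G))"
    by (simp add: dual_def comonad_comparison_def Let_def)
  then show ?thesis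
    unfolding effective_descent_type_def comonadic_def effective_codescent_type_def monadic_def
    using op.adjunction_free adjunction_cofree
      equivalence_dual_iff[of A "monad_comparison A (cofree A G) (Counit G)"] by simp
qed

lemma comodule_galois_opposite:
  "comodule_galois (opposite A) (op_comonad G) (op_monad T) \<alpha> \<longleftrightarrow> module_galois A T G \<alpha>"
proof -
  have "op_comonad G \<circ>\<circ> op_comonad G = G \<circ>\<circ> G" "op_monad T \<circ>\<circ> op_comonad G = T \<circ>\<circ> G"
    by (simp_all add: comp_ftr_def)
  then show ?thesis
    by (simp add: comodule_galois_def module_galois_def nat_iso_opposite_iff)
qed

theorem (in entwining) equivalence_iff_cogalois:
  assumes K: "cat_functor A (Modules (Comodules A G) (lift_monad A T \<Lambda>)) K"
    and over: "eq_ftr A (forget \<circ>\<circ> K) (cofree A G)"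
  shows "equivalence A (Modules (Comodules A G) (lift_monad A T \<Lambda>)) K \<longleftrightarrow>
    module_galois A T G (\<lambda>a. AMap forget (structure_of K a)) \<and> effective_codescent_type A G"
proof -
  interpret op: entwining "opposite A" "op_comonad G" "op_monad T" \<Lambda> by (rule entwining_opposite)
  interpret anti_isomorphism "Modules (Comodules A G) (lift_monad A T \<Lambda>)"
    "Comodules (Modules (opposite A) (op_comonad G)) (lift_comonad (opposite A) (op_monad T) \<Lambda>)"
    "map_prod (\<lambda>x. x) reverse"
    "\<lambda>(x, f, y). (map_prod (\<lambda>x. x) reverse y, reverse f, map_prod (\<lambda>x. x) reverse x)"
    by (rule anti_isomorphism_lift)
  have "eq_ftr (opposite A) (forget \<circ>\<circ> dual K) (free (opposite A) (op_comonad G))"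
    using over by (auto simp: eq_ftr_def split_beta)
  note op.equivalence_iff_galois[OF functor_dual[OF K] this]
  moreover have "AMap forget (structure_of (dual K) a) = AMap forget (structure_of K a)" for a
    by (simp add: structure_of_def)
  ultimately show ?thesis
    by (simp only: equivalence_dual_iff comodule_galois_opposite G.effective_codescent_type_opposite)
qed

theorem theorem1p12:
  fixes A :: "('o, 'm) category"
    and T :: "('o, 'm) monad"
    and G :: "('o, 'm) comonad"
    and \<Lambda> :: "'o \<Rightarrow> 'm"
  assumes "category A"
    and "monad A T"
    and "comonad A G"
    and "entwining A T G \<Lambda>"
  shows
    "(\<forall>K :: ('o, 'm, (('o, 'm) em_obj, ('o, 'm) em_arr) em_obj,
                      (('o, 'm) em_obj, ('o, 'm) em_arr) em_arr) ftr.
        cat_functor A (Comodules (Modules A T) (lift_comonad A G \<Lambda>)) K \<and>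
        eq_ftr A (forget \<circ>\<circ> K) (free A T) \<longrightarrow>
        (equivalence A (Comodules (Modules A T) (lift_comonad A G \<Lambda>)) K \<longleftrightarrow>
           comodule_galois A T G (\<lambda>a. AMap forget (structure_of K a)) \<and>
           effective_descent_type A T)) \<and>
     (\<forall>K :: ('o, 'm, (('o, 'm) em_obj, ('o, 'm) em_arr) em_obj,
                      (('o, 'm) em_obj, ('o, 'm) em_arr) em_arr) ftr.
        cat_functor A (Modules (Comodules A G) (lift_monad A T \<Lambda>)) K \<and>
        eq_ftr A (forget \<circ>\<circ> K) (cofree A G) \<longrightarrow>
        (equivalence A (Modules (Comodules A G) (lift_monad A T \<Lambda>)) K \<longleftrightarrow>
           module_galois A T G (\<lambda>a. AMap forget (structure_of K a)) \<and>
           effective_codescent_type A G))"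
proof -
  interpret entwining A T G \<Lambda> by fact
  show ?thesis using equivalence_iff_galois equivalence_iff_cogalois by blast
qed

end
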